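(* Let $d \geq 1$, $s \in (0,1)$, $p \in (1,\infty)$ with $sp \neq 1$. Then there exists a constant $M_0 > 0$ depending only on $d$, $s$, and $p$ with the following property: for any epigraph $D\subset\mathbb{R}^d$ supported by a function $f$ with Lipschitz constant $M < M_0$, there exists a constant $C = C(d,s,p,M_0)$ such that for every $\mathbf{u} \in [C^1_c(D)]^d$, $$|\mathbf{u}|_{W^{s,p}(D)} \leq C\, [\mathbf{u}]_{\mathcal{X}^{s,p}(D)}.$$
   Context: Write points of $\mathbb{R}^d$ as $\mathbf{x}=(\mathbf{x}',x_d)$ with $\mathbf{x}'\in\mathbb{R}^{d-1}$. Let $f:\mathbb{R}^{d-1}\to\mathbb{R}$ be a $C^1$ globally Lipschitz function with $f(0)=0$ and $\nabla f(0)=0$. The epigraph supported by (determined by) $f$ is $D=\{(\mathbf{x}',x_d)\in\mathbb{R}^d : x_d>f(\mathbf{x}')\}$, and its Lipschitz constant is $M:=\|\nabla f\|_{L^\infty(\mathbb{R}^{d-1})}$. For a vector field $\mathbf{u}:D\to\mathbb{R}^d$, $$[\mathbf{u}]_{\mathcal{X}^{s,p}(D)}^p := \int_D\int_D \frac{\left| (\mathbf{u}(\mathbf{x})-\mathbf{u}(\mathbf{y}))\cdot\frac{\mathbf{x}-\mathbf{y}}{|\mathbf{x}-\mathbf{y}|}\right|^p}{|\mathbf{x}-\mathbf{y}|^{d+sp}}\,d\mathbf{y}\,d\mathbf{x}, \qquad |\mathbf{u}|_{W^{s,p}(D)}^p := \int_D\int_D \frac{|\mathbf{u}(\mathbf{x})-\mathbf{u}(\mathbf{y})|^p}{|\mathbf{x}-\mathbf{y}|^{d+sp}}\,d\mathbf{y}\,d\mathbf{x}.$$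 $[C^1_c(D)]^d$ denotes the set of continuously differentiable vector fields $\mathbf{u}:D\to\mathbb{R}^d$ whose support is compactly contained in $D$. *)

theory Defs
  imports "HOL-Probability.Essential_Supremum"
begin

text \<open>
  Points of Euclidean \<open>d\<close>-space are elements of \<open>real ^ 'n\<close> with \<open>CARD('n) = d\<close>, and the
  \<open>vertical\<close> coordinate \<open>x\<^sub>d\<close> is \<open>x $ k\<close> for a distinguished index \<open>k\<close>.  Since HOL has
  no empty types, the space of the horizontal variables \<open>x' = (x $ i)\<close>, \<open>i \<noteq> k\<close>, is not itself of the form
  \<open>real ^ 'm\<close> when \<open>d = 1\<close>.  A function of \<open>x'\<close> is therefore given by its lift to \<open>real ^ 'n\<close>,
  that is, by a function not depending on \<open>x $ k\<close>.  The lift is of class \<open>C\<^sup>1\<close> or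
  Lipschitz iff the original function is, its gradient is the original gradient with
  \<open>k\<close>-component 0, and the essential supremum of the norm of the gradient is unchanged.
\<close>

definition horizontal :: "'n::finite \<Rightarrow> (real ^ 'n \<Rightarrow> real) \<Rightarrow> bool" where
  "horizontal k f \<longleftrightarrow> (\<forall>x y. (\<forall>i. i \<noteq> k \<longrightarrow> x $ i = y $ i) \<longrightarrow> f x = f y)"

text \<open>Continuous differentiability; only meant for open \<open>S\<close>.\<close>

definition C1_on :: "'a::real_normed_vector set \<Rightarrow> ('a \<Rightarrow> 'b::real_normed_vector) \<Rightarrow> bool" where
  "C1_on S u \<longleftrightarrow>
     (\<exists>u' :: 'a \<Rightarrow> 'a \<Rightarrow>\<^sub>L 'b.
        (\<forall>x\<in>S. (u has_derivative blinfun_apply (u' x)) (at x)) \<and> continuous_on S u')"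

definition grad :: "('a::real_inner \<Rightarrow> real) \<Rightarrow> 'a \<Rightarrow> 'a" where
  "grad f x = (THE D. GDERIV f x :> D)"

definition grad_Linf :: "(real ^ 'n::finite \<Rightarrow> real) \<Rightarrow> ereal" where
  "grad_Linf f = esssup lborel (\<lambda>x. ereal (norm (grad f x)))"

definition supporting_function :: "'n::finite \<Rightarrow> (real ^ 'n \<Rightarrow> real) \<Rightarrow> bool" where
  "supporting_function k f \<longleftrightarrow>
     horizontal k f \<and> C1_on UNIV f \<and> (\<exists>L. L-lipschitz_on UNIV f) \<and> f 0 = 0 \<and> grad f 0 = 0"

definition epigraph_of :: "'n::finite \<Rightarrow> (real ^ 'n \<Rightarrow> real) \<Rightarrow> (real ^ 'n) set" where
  "epigraph_of k f = {x. x $ k > f x}"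

definition C1_c :: "(real ^ 'n::finite) set \<Rightarrow> (real ^ 'n \<Rightarrow> real ^ 'n) set" where
  "C1_c D = {u. C1_on D u \<and> compact (closure (support_on D u)) \<and> closure (support_on D u) \<subseteq> D}"

text \<open>
  The double integrals are taken in the extended nonnegative reals.  The value of the
  integrands on the null set \<open>x = y\<close> is 0 by the convention on division by zero.
\<close>

definition X_energy ::
  "real \<Rightarrow> real \<Rightarrow> (real ^ 'n::finite) set \<Rightarrow> (real ^ 'n \<Rightarrow> real ^ 'n) \<Rightarrow> ennreal" where
  "X_energy s p D u =
     (\<integral>\<^sup>+x\<in>D. (\<integral>\<^sup>+y\<in>D.
        ennreal (\<bar>(u x - u y) \<bullet> ((x - y) /\<^sub>R norm (x - y))\<bar> powr p
                  / norm (x - y) powr (real CARD('n) + s * p)) \<partial>lborel) \<partial>lborel)"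

definition W_energy ::
  "real \<Rightarrow> real \<Rightarrow> (real ^ 'n::finite) set \<Rightarrow> (real ^ 'n \<Rightarrow> real ^ 'n) \<Rightarrow> ennreal" where
  "W_energy s p D u =
     (\<integral>\<^sup>+x\<in>D. (\<integral>\<^sup>+y\<in>D.
        ennreal (norm (u x - u y) powr p
                  / norm (x - y) powr (real CARD('n) + s * p)) \<partial>lborel) \<partial>lborel)"

text \<open>The \<open>p\<close>-th root on the extended nonnegative reals, for \<open>p > 0\<close>.\<close>

definition ennroot :: "real \<Rightarrow> ennreal \<Rightarrow> ennreal" where
  "ennroot p a = (if a = top then top else ennreal (enn2real a powr (1 / p)))"

definition X_seminorm ::
  "real \<Rightarrow> real \<Rightarrow> (real ^ 'n::finite) set \<Rightarrow> (real ^ 'n \<Rightarrow> real ^ 'n) \<Rightarrow> ennreal" where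
  "X_seminorm s p D u = ennroot p (X_energy s p D u)"

definition W_seminorm ::
  "real \<Rightarrow> real \<Rightarrow> (real ^ 'n::finite) set \<Rightarrow> (real ^ 'n \<Rightarrow> real ^ 'n) \<Rightarrow> ennreal" where
  "W_seminorm s p D u = ennroot p (W_energy s p D u)"

end

theory Submission
  imports Defs
begin

text \<open>
  Set \<open>d = CARD('n)\<close>, \<open>b = d + s p\<close> and \<open>M\<^sub>0 = 1 / (4 d)\<close>.  For gradients below \<open>M\<^sub>0\<close> the
  epigraph \<open>D\<close> is stable under adding vectors from a fixed cone around the diagonal (all coordinates
  positive and comparable), whatever the vertical direction \<open>k\<close> is.  An averaging argument reduces the
  full Gagliardo energy to the differences \<open>u(x + h) - u(x)\<close> with \<open>h\<close> in this cone.  By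
  \<open>2 (u(x + h) - u(x)) = (u(x + 2 h) - u(x)) - (u(x) - 2 u(x + h) + u(x + 2 h))\<close> and scaling, the
  seminorm of the first differences is at most \<open>2\<^bsup>s-1\<^esup> < 1\<close> times itself plus a multiple of the seminorm
  of the second differences, so it can be absorbed.  Finally, a second difference annihilates
  rigid motions; with one additional point \<open>q = x + h + w\<close>, its component along \<open>w\<close> is a combination of
  the projected differences of \<open>u\<close> along the four segments \<open>[x, x + 2 h]\<close>, \<open>[x, q]\<close>, \<open>[x + h, q]\<close> and
  \<open>[x + 2 h, q]\<close>.
\<close>

subsection \<open>Integrals and elementary inequalities\<close>

text \<open>Increments run through \<open>cone 2\<close>, while domains are stable under
  \<open>cone 4\<close>: diagonal maps whose entries vary by a factor of at most 2 send the first
  cone into the second. The condition is symmetric in the coordinates, so one cone serves every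
  vertical index.\<close>

definition cone :: "real \<Rightarrow> (real ^ 'n::finite) set" where
  "cone c = {h. \<forall>i j. 0 < h $ i \<and> h $ i \<le> c * h $ j}"

definition diag :: "real ^ 'n::finite \<Rightarrow> real ^ 'n \<Rightarrow> real ^ 'n" where
  "diag c h = (\<chi> i. c $ i * h $ i)"

lemma cone_borel [measurable]: "(cone c :: (real ^ 'n::finite) set) \<in> sets borel"
  unfolding cone_def by measurable

lemma diag_borel [measurable]: "(diag c :: real ^ 'n::finite \<Rightarrow> _) \<in> borel_measurable borel"
  unfolding diag_def by (intro borel_measurable_continuous_onI continuous_intros)

section \<open>Changes of variables for Lebesgue measure\<close>

lemma nn_integral_translate:
  fixes c :: "'a::euclidean_space"
  assumes [measurable]: "f \<in> borel_measurable borel"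
  shows "(\<integral>\<^sup>+x. f (x + c) \<partial>lborel) = (\<integral>\<^sup>+x. f x \<partial>lborel)"
proof -
  have "(\<integral>\<^sup>+x. f x \<partial>lborel) = (\<integral>\<^sup>+x. f x \<partial>distr lborel borel ((+) c))"
    by (simp add: lborel_distr_plus)
  also have "\<dots> = (\<integral>\<^sup>+x. f (x + c) \<partial>lborel)"
    by (subst nn_integral_distr) (simp_all add: add.commute)
  finally show ?thesis by simp
qed

lemma nn_integral_diag:
  fixes c :: "real ^ 'n::finite"
  assumes [measurable]: "f \<in> borel_measurable borel" and c: "\<And>i. c $ i \<noteq> 0"
  shows "(\<integral>\<^sup>+x. f x \<partial>lborel) = ennreal (\<Prod>i\<in>UNIV. \<bar>c $ i\<bar>) * (\<integral>\<^sup>+x. f (diag c x) \<partial>lborel)"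
proof -
  have diag_eq: "diag c x = 0 + (\<Sum>j\<in>Basis. ((c \<bullet> j) * (x \<bullet> j)) *\<^sub>R j)" for x
    by (subst euclidean_representation[symmetric, of "diag c x"])
       (auto intro!: sum.cong simp: Basis_vec_def inner_axis diag_def)
  have prod_eq: "(\<Prod>j\<in>Basis. \<bar>c \<bullet> j\<bar>) = (\<Prod>i\<in>UNIV. \<bar>c $ i\<bar>)"
  proof -
    have B: "(Basis :: (real ^ 'n) set) = (\<lambda>i. axis i 1) ` UNIV"
      by (auto simp: Basis_vec_def)
    have "inj (\<lambda>i::'n. axis i (1::real))" by (auto simp: inj_on_def axis_eq_axis)
    then show ?thesis unfolding B by (simp add: prod.reindex inner_axis)
  qed
  have "c \<bullet> j \<noteq> 0" if "j \<in> Basis" for j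
    using that c by (auto simp: Basis_vec_def inner_axis)
  note lborel_affine_euclidean[of "\<lambda>j. c \<bullet> j" 0, OF this, folded diag_eq, unfolded prod_eq]
  then have "(\<integral>\<^sup>+x. f x \<partial>lborel) =
      (\<integral>\<^sup>+x. f x \<partial>density (distr lborel borel (diag c)) (\<lambda>_. ennreal (\<Prod>i\<in>UNIV. \<bar>c $ i\<bar>)))"
    by simp
  also have "\<dots> = ennreal (\<Prod>i\<in>UNIV. \<bar>c $ i\<bar>) * (\<integral>\<^sup>+x. f (diag c x) \<partial>lborel)"
    by (simp add: nn_integral_density nn_integral_distr nn_integral_cmult)
  finally show ?thesis .
qed

text \<open>Entries of at least 1 give a Jacobian determinant of at least 1, which may be
  dropped.\<close>

lemma nn_integral_diag_le:
  fixes c :: "real ^ 'n::finite"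
  assumes [measurable]: "f \<in> borel_measurable borel" and c: "\<And>i. c $ i \<ge> 1"
  shows "(\<integral>\<^sup>+x. f (diag c x) \<partial>lborel) \<le> (\<integral>\<^sup>+x. f x \<partial>lborel)"
proof -
  have "1 \<le> (\<Prod>i\<in>UNIV. \<bar>c $ i\<bar>)"
    using c by (intro prod_ge_1) (metis abs_ge_self order_trans)
  then have "1 \<le> ennreal (\<Prod>i\<in>UNIV. \<bar>c $ i\<bar>)" by simp
  then have "1 * (\<integral>\<^sup>+x. f (diag c x) \<partial>lborel)
      \<le> ennreal (\<Prod>i\<in>UNIV. \<bar>c $ i\<bar>) * (\<integral>\<^sup>+x. f (diag c x) \<partial>lborel)"
    by (intro mult_right_mono) auto
  moreover have "c $ i \<noteq> 0" for i
    using c[of i] by auto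
  ultimately show ?thesis
    using nn_integral_diag[OF assms(1), of c] by simp
qed

section \<open>Inequalities for real powers\<close>

text \<open>If \<open>b \<le> \<eta> * a\<close>, the sum is at most
  \<open>(1 + \<eta>) * a\<close>, otherwise at most \<open>(1 + 1 / \<eta>) * b\<close>. A small
  \<open>\<eta>\<close> brings the coefficient of \<open>a powr p\<close> close to 1, which leaves
  room for absorption.\<close>

lemma powr_add_le_weighted:
  fixes a b \<eta> p :: real
  assumes "0 \<le> a" "0 \<le> b" "0 < \<eta>" "0 < p"
  shows "(a + b) powr p \<le> (1 + \<eta>) powr p * a powr p + (1 + 1 / \<eta>) powr p * b powr p"
proof (cases "b \<le> \<eta> * a")
  case True
  then have "(a + b) powr p \<le> ((1 + \<eta>) * a) powr p"
    using assms by (intro powr_mono2) (auto simp: algebra_simps)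
  then show ?thesis using assms by (simp add: powr_mult add_increasing2)
next
  case False
  then have "(a + b) powr p \<le> ((1 + 1 / \<eta>) * b) powr p"
    using assms by (intro powr_mono2) (auto simp: field_simps)
  then show ?thesis using assms by (simp add: powr_mult add_increasing)
qed

text \<open>The sum is at most \<open>card A\<close> times its largest term, whose power occurs
  among the terms on the right.\<close>

lemma powr_sum_le:
  fixes f :: "'a \<Rightarrow> real"
  assumes "finite A" "\<And>i. i \<in> A \<Longrightarrow> 0 \<le> f i" "0 < p"
  shows "(\<Sum>i\<in>A. f i) powr p \<le> card A powr p * (\<Sum>i\<in>A. f i powr p)"
proof (cases "A = {}")
  case False
  then obtain k where k: "k \<in> A" "\<And>i. i \<in> A \<Longrightarrow> f i \<le> f k"
    using obtains_MAX[OF assms(1) False, of f] assms(1) by (metis Max_ge finite_imageI imageI)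
  have "(\<Sum>i\<in>A. f i) powr p \<le> (card A * f k) powr p"
    using assms k by (intro powr_mono2 sum_nonneg sum_bounded_above) auto
  also have "\<dots> = card A powr p * f k powr p"
    using assms k by (simp add: powr_mult)
  also have "\<dots> \<le> card A powr p * (\<Sum>i\<in>A. f i powr p)"
    using assms k member_le_sum[of k A "\<lambda>i. f i powr p"] by (intro mult_left_mono) auto
  finally show ?thesis .
qed simp

lemma powr_add_le:
  fixes a b p :: real
  assumes "0 \<le> a" "0 \<le> b" "0 < p"
  shows "(a + b) powr p \<le> 2 powr p * (a powr p + b powr p)"
  using powr_add_le_weighted[of a b 1 p] assms by (simp add: algebra_simps)

section \<open>Integrability of the kernel away from the origin\<close>

lemma emeasure_cball_le:
  "\<exists>c>0. \<forall>r\<ge>0. emeasure lborel (cball (x::'a::euclidean_space) r) \<le> ennreal (c * r ^ DIM('a))"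
  by (rule exI[of _ "unit_ball_vol (DIM('a))"]) (simp add: emeasure_cball)

lemma suminf_upper_ennreal: "F n \<le> (\<Sum>n. F n)" for F :: "nat \<Rightarrow> ennreal"
  using sum_le_suminf[OF summableI, of "{n}" F] by simp

text \<open>Dyadic shells: on the \<open>n\<close>-th one the kernel is at most
  \<open>(e * 2 ^ n) powr (- b)\<close>, and the enclosing ball has volume of order
  \<open>(e * 2 ^ Suc n) ^ d\<close>. The contributions form a geometric series of ratio
  \<open>2 powr (d - b) < 1\<close>.\<close>

lemma nn_integral_norm_powr_tail:
  fixes b e :: real
  assumes b: "real DIM('a::euclidean_space) < b" and e: "0 < e"
  shows "(\<integral>\<^sup>+h. ennreal (norm h powr (- b)) * indicator {h::'a. e < norm h} h \<partial>lborel) < \<infinity>"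
proof -
  let ?d = "DIM('a)"
  obtain c where c: "c > 0" "\<And>r. r \<ge> 0 \<Longrightarrow> emeasure lborel (cball (0::'a) r) \<le> ennreal (c * r ^ ?d)"
    using emeasure_cball_le by blast
  define C where "C = c * e powr (- b) * (2 * e) ^ ?d"
  define q where "q = 2 powr (real ?d - b)"
  have C0: "0 \<le> C" using c e by (simp add: C_def)
  have q: "0 < q" "q < 1" using b by (auto simp: q_def powr_less_one)
  let ?f = "\<lambda>n::nat. \<lambda>h::'a. ennreal ((e * 2 ^ n) powr (- b)) * indicator (cball 0 (e * 2 ^ Suc n)) h"
  have "(\<integral>\<^sup>+h. ennreal (norm h powr (- b)) * indicator {h::'a. e < norm h} h \<partial>lborel)
      \<le> (\<integral>\<^sup>+h. (\<Sum>n. ?f n h) \<partial>lborel)"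
  proof (rule nn_integral_mono)
    fix h :: 'a
    show "ennreal (norm h powr (- b)) * indicator {h::'a. e < norm h} h \<le> (\<Sum>n. ?f n h)"
    proof (cases "e < norm h")
      case True
      \<comment> \<open>Minimality also yields the lower bound
        \<open>e * 2 ^ n \<le> norm h\<close>; for \<open>n = 0\<close> that bound is the truncation
        itself.\<close>
      define n where "n = (LEAST n. norm h \<le> e * 2 ^ Suc n)"
      obtain m where "norm h / e < 2 ^ m" using real_arch_pow[of 2] by auto
      then have "norm h < e * 2 ^ m" using e by (simp add: field_simps)
      also have "\<dots> \<le> e * 2 ^ Suc m" using e by simp
      finally have "norm h \<le> e * 2 ^ Suc m" by simp
      then have n: "norm h \<le> e * 2 ^ Suc n" unfolding n_def by (rule LeastI)
      have n': "e * 2 ^ n \<le> norm h"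
      proof (cases n)
        case 0 then show ?thesis using True by simp
      next
        case (Suc k)
        then have "\<not> norm h \<le> e * 2 ^ Suc k"
          using not_less_Least[of k "\<lambda>n. norm h \<le> e * 2 ^ Suc n"] by (auto simp: n_def)
        then show ?thesis using Suc by simp
      qed
      have "norm h powr (- b) \<le> (e * 2 ^ n) powr (- b)"
        using n' e b by (intro powr_mono2') auto
      then have "ennreal (norm h powr (- b)) * indicator {h::'a. e < norm h} h \<le> ?f n h"
        using n by (auto simp: indicator_def intro: ennreal_leI)
      also have "\<dots> \<le> (\<Sum>n. ?f n h)"
        by (rule suminf_upper_ennreal)
      finally show ?thesis .
    qed simp
  qed
  also have "\<dots> = (\<Sum>n. \<integral>\<^sup>+h. ?f n h \<partial>lborel)"
    by (rule nn_integral_suminf)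
       (intro borel_measurable_times_ennreal borel_measurable_const borel_measurable_indicator, simp)
  also have "\<dots> \<le> (\<Sum>n. ennreal (C * q ^ n))"
  proof (rule suminf_le)
    fix n
    have "(\<integral>\<^sup>+h. ?f n h \<partial>lborel)
        = ennreal ((e * 2 ^ n) powr (- b)) * emeasure lborel (cball (0::'a) (e * 2 ^ Suc n))"
      by (rule nn_integral_cmult_indicator) simp
    also have "\<dots> \<le> ennreal ((e * 2 ^ n) powr (- b)) * ennreal (c * (e * 2 ^ Suc n) ^ ?d)"
      using e by (intro mult_left_mono c(2)) (simp_all del: power_Suc)
    also have "\<dots> = ennreal ((e * 2 ^ n) powr (- b) * (c * (e * 2 ^ Suc n) ^ ?d))"
      by (simp add: ennreal_mult')
    also have "(e * 2 ^ n) powr (- b) * (c * (e * 2 ^ Suc n) ^ ?d) = C * q ^ n"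
    proof -
      have "(2 ^ n) powr (- b) = ((2::real) powr (- b)) ^ n"
      proof -
        have "(2 ^ n) powr (- b) = (2::real) powr (real n * (- b))"
          by (simp add: powr_realpow[symmetric] powr_powr)
        also have "\<dots> = (2 powr (- b)) powr real n" by (simp add: powr_powr mult.commute)
        finally show ?thesis by (simp add: powr_realpow)
      qed
      moreover have "q = (2::real) ^ ?d * 2 powr (- b)"
        by (simp add: q_def powr_diff powr_minus powr_realpow divide_inverse)
      moreover have "(e * 2 ^ Suc n) ^ ?d = (2 * e) ^ ?d * (2 ^ ?d) ^ n"
        by (simp add: power_mult_distrib power_mult[symmetric] mult.commute)
      ultimately show ?thesis
        using e by (simp add: C_def powr_mult power_mult_distrib)
    qed
    finally show "(\<integral>\<^sup>+h. ?f n h \<partial>lborel) \<le> ennreal (C * q ^ n)" .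
  qed (rule summableI)+
  also have "\<dots> = ennreal (\<Sum>n. C * q ^ n)"
    using q C0 by (intro suminf_ennreal2 summable_mult summable_geometric) auto
  also have "\<dots> < \<infinity>" by simp
  finally show ?thesis .
qed

text \<open>
  The points are \<open>x\<close>, \<open>x + h\<close>, \<open>x + 2 h\<close> and \<open>q = x + h + w\<close>, with values \<open>a\<close>, \<open>b\<close>, \<open>c\<close> and \<open>q\<close>
  of the field; each term on the right is a difference of values tested against the difference of
  their points (up to a factor 2).
\<close>

lemma second_difference_identity:
  fixes a b c q h w :: "'a::real_inner"
  shows "w \<bullet> (a - 2 *\<^sub>R b + c) =
    (c - a) \<bullet> h - (q - a) \<bullet> (h + w) - (q - c) \<bullet> (w - h) + 2 * ((q - b) \<bullet> w)"
  by (simp add: inner_simps inner_commute algebra_simps)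

subsection \<open>Energies over the cone\<close>

text \<open>The properties of the zero extension of \<open>u\<close> on which the estimates rest.
  Boundedness and bounded support make the truncated cone energy finite.\<close>

definition admissible :: "(real ^ 'n::finite) set \<Rightarrow> (real ^ 'n \<Rightarrow> real ^ 'n) \<Rightarrow> bool" where
  "admissible D v \<longleftrightarrow> D \<in> sets borel \<and> (\<forall>x\<in>D. \<forall>h\<in>cone 4. x + h \<in> D) \<and>
     v \<in> borel_measurable borel \<and> (\<exists>B. \<forall>x. norm (v x) \<le> B) \<and> (\<exists>R. \<forall>x. v x \<noteq> 0 \<longrightarrow> norm x \<le> R)"

definition full_energy where
  "full_energy b p D v =
     (\<integral>\<^sup>+x. (\<integral>\<^sup>+g. ennreal (norm (v (x + g) - v x) powr p / norm g powr b)
        * indicator D (x + g) * indicator D (x :: real ^ 'n::finite) \<partial>lborel) \<partial>lborel)"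
  for v :: "real ^ 'n::finite \<Rightarrow> real ^ 'n"

text \<open>This is \<open>X_energy\<close> in the variable \<open>g = y - x\<close>, with
  \<open>b = d + s * p\<close>; the normalization of the direction is moved into the exponent
  \<open>p + b\<close>.\<close>

definition proj_energy where
  "proj_energy b p D v =
     (\<integral>\<^sup>+x. (\<integral>\<^sup>+g. ennreal (\<bar>(v (x + g) - v x) \<bullet> g\<bar> powr p / norm g powr (p + b))
        * indicator D (x + g) * indicator D x \<partial>lborel) \<partial>lborel)"
  for v :: "real ^ 'n::finite \<Rightarrow> real ^ 'n"

text \<open>The truncation at \<open>e\<close> makes the energy finite, so that a multiple of it can
  be subtracted. Only \<open>x\<close> is restricted to \<open>D\<close>: for admissible
  \<open>D\<close>, stability under the cone then puts \<open>x + h\<close> in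
  \<open>D\<close>.\<close>

definition cone_energy where
  "cone_energy b p D v e =
     (\<integral>\<^sup>+x. (\<integral>\<^sup>+h. ennreal (norm (v (x + h) - v x) powr p / norm h powr b)
        * indicator {h \<in> cone 2. e < norm h} h * indicator D x \<partial>lborel) \<partial>lborel)"
  for v :: "real ^ 'n::finite \<Rightarrow> real ^ 'n"

definition second_energy where
  "second_energy b p D v =
     (\<integral>\<^sup>+x. (\<integral>\<^sup>+h. ennreal (norm (v x - 2 *\<^sub>R v (x + h) + v (x + 2 *\<^sub>R h)) powr p / norm h powr b)
        * indicator (cone 2) h * indicator D x \<partial>lborel) \<partial>lborel)"
  for v :: "real ^ 'n::finite \<Rightarrow> real ^ 'n"

lemma cone_norm_pos: "h \<in> cone c \<Longrightarrow> 0 < norm h"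
  by (auto simp: cone_def)

text \<open>Taken with \<open>c = 4\<close> at the vertical coordinate, this explains the slope
  bound \<open>1 / (4 * d)\<close>.\<close>

lemma cone_norm_le:
  fixes h :: "real ^ 'n::finite"
  assumes "h \<in> cone c"
  shows "norm h \<le> c * real CARD('n) * h $ i"
proof -
  have "norm h \<le> (\<Sum>j\<in>UNIV. \<bar>h $ j\<bar>)" by (rule norm_le_l1_cart)
  also have "\<dots> \<le> (\<Sum>j\<in>(UNIV :: 'n set). c * h $ i)"
    using assms by (intro sum_mono) (simp add: cone_def abs_of_pos)
  finally show ?thesis by (simp add: mult_ac)
qed

lemma norm_diag_le:
  assumes "\<And>i. 0 \<le> c $ i" "\<And>i. c $ i \<le> m" "0 \<le> m"
  shows "norm (diag c h) \<le> m * norm h"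
proof -
  have "norm (diag c h) \<le> norm (m *\<^sub>R h)"
    using assms by (intro norm_le_componentwise_cart) (auto simp: diag_def abs_mult intro!: mult_right_mono)
  then show ?thesis using assms by simp
qed

text \<open>Substitute \<open>y = x + \<alpha> *\<^sub>R h\<close> and \<open>g = diag S h\<close>
  in the projected energy. The lower bound on \<open>S\<close> controls the Jacobian, the upper
  bound compares \<open>norm g\<close> with \<open>norm h\<close>, and the ratio condition keeps the
  end point in \<open>D\<close>.\<close>

lemma bar_energy_le:
  fixes v :: "real ^ 'n::finite \<Rightarrow> real ^ 'n" and S :: "real ^ 'n"
  assumes adm: "admissible D v" and "0 < p" "0 < b" and \<alpha>: "0 \<le> \<alpha>"
    and S: "\<And>i. 1 \<le> S $ i" "\<And>i. S $ i \<le> 4" "\<And>i j. \<alpha> + S $ i \<le> 2 * (\<alpha> + S $ j)"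
  shows "(\<integral>\<^sup>+x. (\<integral>\<^sup>+h. ennreal (\<bar>(v (x + \<alpha> *\<^sub>R h + diag S h) - v (x + \<alpha> *\<^sub>R h)) \<bullet> diag S h\<bar> powr p
             / norm h powr (p + b)) * indicator (cone 2) h * indicator D x \<partial>lborel) \<partial>lborel)
         \<le> ennreal (4 powr (p + b)) * proj_energy b p D v"
proof -
  have [measurable]: "D \<in> sets borel" "v \<in> borel_measurable borel"
    and D: "\<And>x h. x \<in> D \<Longrightarrow> h \<in> cone 4 \<Longrightarrow> x + h \<in> D"
    using adm by (auto simp: admissible_def)
  define K where "K y g = ennreal (\<bar>(v (y + g) - v y) \<bullet> g\<bar> powr p / norm g powr (p + b))
      * indicator D (y + g) * indicator D y" for y g
  have [measurable]: "case_prod K \<in> borel_measurable (borel \<Otimes>\<^sub>M borel)"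
    unfolding K_def by measurable
  let ?J = "\<lambda>x h. ennreal (\<bar>(v (x + \<alpha> *\<^sub>R h + diag S h) - v (x + \<alpha> *\<^sub>R h)) \<bullet> diag S h\<bar> powr p
             / norm h powr (p + b)) * indicator (cone 2) h * indicator D x"
  have J_le: "?J x h \<le> ennreal (4 powr (p + b)) * K (x + \<alpha> *\<^sub>R h) (diag S h)" for x h
  proof (cases "h \<in> cone 2 \<and> x \<in> D")
    case True
    \<comment> \<open>The zero vector is not in the cone, so \<open>\<alpha> = 0\<close> is treated
      apart.\<close>
    have xD: "x + \<alpha> *\<^sub>R h \<in> D"
    proof (cases "\<alpha> = 0")
      case False
      have "\<alpha> *\<^sub>R h \<in> cone 4"
        unfolding cone_def
      proof (intro CollectI allI conjI)
        fix i j
        have h: "0 < h $ i" "0 < h $ j" "h $ i \<le> 2 * h $ j" using True by (auto simp: cone_def)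
        show "0 < (\<alpha> *\<^sub>R h) $ i" using h \<alpha> False by simp
        have "h $ i \<le> 4 * h $ j" using h by linarith
        then show "(\<alpha> *\<^sub>R h) $ i \<le> 4 * (\<alpha> *\<^sub>R h) $ j"
          using mult_left_mono[OF _ \<alpha>] by fastforce
      qed
      then show ?thesis using D True by blast
    qed (use True in auto)
    \<comment> \<open>The coefficients \<open>\<alpha> + S $ i\<close> and the coordinates of
      \<open>h\<close> each vary by a factor of at most 2, hence their products by at most
      4.\<close>
    have "\<alpha> *\<^sub>R h + diag S h \<in> cone 4"
      unfolding cone_def
    proof (intro CollectI allI conjI)
      fix i j
      have h: "0 < h $ i" "0 < h $ j" "h $ i \<le> 2 * h $ j" using True by (auto simp: cone_def)
      have pos: "0 < \<alpha> + S $ i" using S(1)[of i] \<alpha> by simp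
      show "0 < (\<alpha> *\<^sub>R h + diag S h) $ i"
        using pos h by (simp add: diag_def distrib_right[symmetric])
      have "(\<alpha> + S $ i) * h $ i \<le> (2 * (\<alpha> + S $ j)) * (2 * h $ j)"
        using S(1)[of i] S(1)[of j] S(3)[of i j] \<alpha> h by (intro mult_mono) auto
      then show "(\<alpha> *\<^sub>R h + diag S h) $ i \<le> 4 * (\<alpha> *\<^sub>R h + diag S h) $ j"
        by (simp add: diag_def algebra_simps)
    qed
    then have xD': "x + \<alpha> *\<^sub>R h + diag S h \<in> D"
      using D[of x] True by (simp add: add.assoc)
    have h: "0 < norm h" using True cone_norm_pos by blast
    obtain i :: 'n where True by simp
    have "0 < (diag S h) $ i"
      using S(1)[of i] True by (auto simp: diag_def cone_def intro!: mult_pos_pos)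
    then have dpos: "0 < norm (diag S h)" by auto
    have "norm (diag S h) powr (p + b) \<le> (4 * norm h) powr (p + b)"
      using S assms by (intro powr_mono2 norm_diag_le) (auto intro: order_trans[of 0 1])
    also have "\<dots> = 4 powr (p + b) * norm h powr (p + b)" by (simp add: powr_mult)
    finally have recip: "1 / norm h powr (p + b) \<le> 4 powr (p + b) / norm (diag S h) powr (p + b)"
      using h dpos by (simp add: field_simps)
    then have "A / norm h powr (p + b) \<le> 4 powr (p + b) * (A / norm (diag S h) powr (p + b))"
      if "0 \<le> A" for A
      using mult_left_mono[OF recip that] by (simp add: mult.commute)
    then show ?thesis
      using True xD xD' by (simp add: K_def ennreal_mult'[symmetric] ennreal_leI)
  qed (auto simp: indicator_def)
  have "(\<integral>\<^sup>+x. (\<integral>\<^sup>+h. ?J x h \<partial>lborel) \<partial>lborel)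
      \<le> (\<integral>\<^sup>+x. (\<integral>\<^sup>+h. ennreal (4 powr (p + b)) * K (x + \<alpha> *\<^sub>R h) (diag S h) \<partial>lborel) \<partial>lborel)"
    by (intro nn_integral_mono J_le)
  also have "\<dots> = ennreal (4 powr (p + b)) * (\<integral>\<^sup>+x. (\<integral>\<^sup>+h. K (x + \<alpha> *\<^sub>R h) (diag S h) \<partial>lborel) \<partial>lborel)"
    by (simp add: nn_integral_cmult)
  \<comment> \<open>The shift depends on \<open>h\<close>: the order is exchanged to translate in
    \<open>x\<close> for fixed \<open>h\<close>, then restored to rescale \<open>h\<close> for fixed
    \<open>x\<close>.\<close>
  also have "(\<integral>\<^sup>+x. (\<integral>\<^sup>+h. K (x + \<alpha> *\<^sub>R h) (diag S h) \<partial>lborel) \<partial>lborel)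
      = (\<integral>\<^sup>+h. (\<integral>\<^sup>+x. K (x + \<alpha> *\<^sub>R h) (diag S h) \<partial>lborel) \<partial>lborel)"
    by (rule lborel_pair.Fubini') measurable
  also have "\<dots> = (\<integral>\<^sup>+h. (\<integral>\<^sup>+x. K x (diag S h) \<partial>lborel) \<partial>lborel)"
    by (subst nn_integral_translate) auto
  also have "\<dots> = (\<integral>\<^sup>+x. (\<integral>\<^sup>+h. K x (diag S h) \<partial>lborel) \<partial>lborel)"
    by (rule lborel_pair.Fubini'[symmetric]) measurable
  also have "\<dots> \<le> (\<integral>\<^sup>+x. (\<integral>\<^sup>+g. K x g \<partial>lborel) \<partial>lborel)"
    by (intro nn_integral_mono nn_integral_diag_le S) measurable
  also have "\<dots> = proj_energy b p D v"
    by (simp add: K_def proj_energy_def)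
  finally show ?thesis by (simp add: mult_left_mono)
qed

subsection \<open>Second differences are controlled by projected differences\<close>

text \<open>
  A pair \<open>(\<alpha>, S)\<close> encodes the segment from \<open>x + \<alpha> h\<close> to \<open>x + \<alpha> h + diag S h\<close>.  The additional
  points \<open>x + h + w\<close> have \<open>w = diag c h\<close>, where \<open>c\<close> is constantly 2 except that one entry may be 3:
  differences of such \<open>w\<close> are the vectors \<open>h\<^sub>i e\<^sub>i\<close>, and the diagonal maps \<open>c\<close>, \<open>c + 1\<close> and \<open>c - 1\<close> are
  invertible, so that every segment can be substituted into the projected energy.
\<close>

definition bars :: "(real \<times> (real ^ 'n::finite)) set" where
  "bars = (\<Union>c \<in> insert (\<chi> j. 2) (range (\<lambda>i. \<chi> j. if j = i then 3 else 2)).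
      {(0, \<chi> j. 2), (0, c + 1), (2, c - 1), (1, c)})"

definition stretch :: "(real ^ 'n::finite \<Rightarrow> real ^ 'n) \<Rightarrow> real ^ 'n \<Rightarrow> real ^ 'n \<Rightarrow> real \<times> (real ^ 'n) \<Rightarrow> real" where
  "stretch v x h = (\<lambda>(\<alpha>, S). \<bar>(v (x + \<alpha> *\<^sub>R h + diag S h) - v (x + \<alpha> *\<^sub>R h)) \<bullet> diag S h\<bar>)"

lemma finite_bars: "finite bars"
  by (simp add: bars_def)

text \<open>Apart from the segment from \<open>x\<close> to \<open>x + 2 h\<close>, every segment
  ends at \<open>x + h + diag c h\<close>, so the entries of \<open>\<alpha> + S\<close> are 3 or
  4.\<close>

lemma bars_bounds:
  assumes "(\<alpha>, S) \<in> bars"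
  shows "0 \<le> \<alpha>" "1 \<le> S $ i" "S $ i \<le> 4" "\<alpha> + S $ i \<le> 2 * (\<alpha> + S $ j)"
  using assms by (auto simp: bars_def split: if_splits)

text \<open>\<open>second_difference_identity\<close> bounds the component of the second difference
  along each \<open>diag c h\<close>. Subtracting two choices of \<open>c\<close> isolates its
  \<open>i\<close>-th coordinate times \<open>h $ i\<close>, and on the cone \<open>h $ i\<close> is
  comparable with \<open>norm h\<close>.\<close>

lemma second_difference_le_stretch:
  fixes v :: "real ^ 'n::finite \<Rightarrow> real ^ 'n"
  assumes h: "h \<in> cone 2"
  shows "norm h * norm (v x - 2 *\<^sub>R v (x + h) + v (x + 2 *\<^sub>R h))
    \<le> 20 * real CARD('n) ^ 2 * (\<Sum>j\<in>bars. stretch v x h j)"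
proof -
  define \<Delta> where "\<Delta> = v x - 2 *\<^sub>R v (x + h) + v (x + 2 *\<^sub>R h)"
  define Z where "Z = (\<Sum>j\<in>bars. stretch v x h j)"
  have Z: "stretch v x h j \<le> Z" if "j \<in> bars" for j
    unfolding Z_def using that by (intro member_le_sum finite_bars) (auto simp: stretch_def)
  \<comment> \<open>The factor 5 adds the coefficients 1, 1, 1 and 2 in
    \<open>second_difference_identity\<close>.\<close>
  have main: "\<bar>diag c h \<bullet> \<Delta>\<bar> \<le> 5 * Z"
    if c: "c \<in> insert (\<chi> j. 2) (range (\<lambda>i. \<chi> j. if j = i then 3 else 2))" for c
  proof -
    have d2: "diag (\<chi> j. 2) h = 2 *\<^sub>R h" by (simp add: diag_def vec_eq_iff)
    have dp: "diag (c + 1) h = h + diag c h" by (simp add: diag_def vec_eq_iff algebra_simps)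
    have dm: "diag (c - 1) h = diag c h - h" by (simp add: diag_def vec_eq_iff algebra_simps)
    have "(0, \<chi> j. 2) \<in> bars" "(0, c + 1) \<in> bars" "(2, c - 1) \<in> bars" "(1, c) \<in> bars"
      unfolding bars_def using c by blast+
    note le = this[THEN Z]
    let ?q = "v (x + h + diag c h)"
    have "\<bar>(v (x + 2 *\<^sub>R h) - v x) \<bullet> h\<bar> \<le> Z"
      using le(1) by (simp add: stretch_def d2 abs_mult)
    moreover have "\<bar>(?q - v x) \<bullet> (h + diag c h)\<bar> \<le> Z"
      using le(2) by (simp add: stretch_def dp add.assoc)
    moreover have "\<bar>(?q - v (x + 2 *\<^sub>R h)) \<bullet> (diag c h - h)\<bar> \<le> Z"
    proof -
      have eq: "x + 2 *\<^sub>R h + (diag c h - h) = x + h + diag c h" by (simp add: scaleR_2)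
      show ?thesis using le(3) unfolding stretch_def prod.case dm eq .
    qed
    moreover have "\<bar>(?q - v (x + h)) \<bullet> diag c h\<bar> \<le> Z"
      using le(4) by (simp add: stretch_def)
    ultimately show ?thesis
      unfolding \<Delta>_def
      using second_difference_identity[of "diag c h" "v x" "v (x + h)" "v (x + 2 *\<^sub>R h)" h ?q]
      by linarith
  qed
  \<comment> \<open>Two bounds by \<open>5 * Z\<close>, together with
    \<open>norm h \<le> 2 * d * h $ i\<close>, give the factor \<open>20 * d\<close>; summing over
    the coordinates later supplies the second \<open>d\<close>.\<close>
  have comp: "norm h * \<bar>\<Delta> $ i\<bar> \<le> 20 * real CARD('n) * Z" for i
  proof -
    let ?c = "(\<chi> j. if j = i then 3 else 2) :: real ^ 'n"
    have "diag ?c h - diag (\<chi> j. 2) h = (h $ i) *\<^sub>R axis i 1"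
      by (simp add: diag_def vec_eq_iff axis_def)
    then have "h $ i * \<Delta> $ i = diag ?c h \<bullet> \<Delta> - diag (\<chi> j. 2) h \<bullet> \<Delta>"
      by (simp add: inner_diff_left[symmetric] inner_axis_axis inner_axis' )
    also have "\<bar>\<dots>\<bar> \<le> 5 * Z + 5 * Z"
      using main[of ?c] main[of "\<chi> j. 2"] by (intro abs_triangle_ineq4[THEN order_trans] add_mono) auto
    finally have "\<bar>h $ i * \<Delta> $ i\<bar> \<le> 10 * Z" by simp
    moreover have "norm h * \<bar>\<Delta> $ i\<bar> \<le> 2 * real CARD('n) * h $ i * \<bar>\<Delta> $ i\<bar>"
      using cone_norm_le[OF h, of i] by (intro mult_right_mono) auto
    moreover have "0 < h $ i" using h by (auto simp: cone_def)
    ultimately have "norm h * \<bar>\<Delta> $ i\<bar> \<le> 2 * real CARD('n) * \<bar>h $ i * \<Delta> $ i\<bar>"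
      by (simp add: abs_mult mult.assoc)
    also have "\<dots> \<le> 2 * real CARD('n) * (10 * Z)"
      using \<open>\<bar>h $ i * \<Delta> $ i\<bar> \<le> 10 * Z\<close> by (intro mult_left_mono) auto
    finally show ?thesis by simp
  qed
  have "norm h * norm \<Delta> \<le> norm h * (\<Sum>i\<in>UNIV. \<bar>\<Delta> $ i\<bar>)"
    by (intro mult_left_mono norm_le_l1_cart) simp
  also have "\<dots> \<le> (\<Sum>i\<in>(UNIV :: 'n set). 20 * real CARD('n) * Z)"
    unfolding sum_distrib_left by (intro sum_mono comp)
  finally show ?thesis
    by (simp add: \<Delta>_def Z_def power2_eq_square mult_ac)
qed

text \<open>In the \<open>p\<close>-th power of the pointwise bound, the factor
  \<open>norm h\<close> raises the exponent of the kernel from \<open>b\<close> to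
  \<open>p + b\<close>. Then \<open>bar_energy_le\<close> applies to each of the finitely many
  segments.\<close>

lemma second_energy_le_proj_energy:
  assumes p: "0 < p" and b: "0 < b"
  shows "\<exists>C>0. \<forall>D (v :: real ^ 'n::finite \<Rightarrow> real ^ 'n). admissible D v \<longrightarrow>
           second_energy b p D v \<le> ennreal C * proj_energy b p D v"
proof -
  let ?bars = "bars :: (real \<times> (real ^ 'n)) set"
  have "?bars \<noteq> {}" by (auto simp: bars_def)
  then have card: "0 < card ?bars" using finite_bars card_gt_0_iff by blast
  define C where "C = (20 * real CARD('n) ^ 2) powr p * card ?bars powr p"
  have C: "0 < C" using card by (simp add: C_def)
  show ?thesis
  proof (intro exI[of _ "C * (card ?bars * 4 powr (p + b))"] conjI allI impI)
    show "0 < C * (card ?bars * 4 powr (p + b))" using C card by simp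
    fix D and v :: "real ^ 'n \<Rightarrow> real ^ 'n"
    assume adm: "admissible D v"
    then have [measurable]: "D \<in> sets borel" "v \<in> borel_measurable borel"
      by (auto simp: admissible_def)
    define F where "F j x h = ennreal (stretch v x h j powr p / norm h powr (p + b))
        * indicator (cone 2) h * indicator D x" for j x h
    have [measurable]: "case_prod (F j) \<in> borel_measurable (borel \<Otimes>\<^sub>M borel)" for j
      unfolding F_def stretch_def by (cases j) simp
    have point: "ennreal (norm (v x - 2 *\<^sub>R v (x + h) + v (x + 2 *\<^sub>R h)) powr p / norm h powr b)
        * indicator (cone 2) h * indicator D x \<le> ennreal C * (\<Sum>j\<in>bars. F j x h)" for x h
    proof (cases "h \<in> cone 2 \<and> x \<in> D")
      case True
      then have h: "h \<in> cone 2" "0 < norm h" using cone_norm_pos by auto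
      let ?\<Delta> = "v x - 2 *\<^sub>R v (x + h) + v (x + 2 *\<^sub>R h)"
      have nonneg: "0 \<le> stretch v x h j" for j by (auto simp: stretch_def split: prod.split)
      have "norm h powr p * norm ?\<Delta> powr p = (norm h * norm ?\<Delta>) powr p"
        by (simp add: powr_mult)
      also have "\<dots> \<le> (20 * real CARD('n) ^ 2 * (\<Sum>j\<in>bars. stretch v x h j)) powr p"
        using second_difference_le_stretch[OF h(1), of v x] p by (intro powr_mono2) auto
      also have "\<dots> = (20 * real CARD('n) ^ 2) powr p * (\<Sum>j\<in>bars. stretch v x h j) powr p"
        using nonneg by (simp add: powr_mult sum_nonneg)
      also have "\<dots> \<le> (20 * real CARD('n) ^ 2) powr p *
          (card ?bars powr p * (\<Sum>j\<in>bars. stretch v x h j powr p))"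
        using nonneg p by (intro mult_left_mono powr_sum_le finite_bars) auto
      finally have "norm h powr p * norm ?\<Delta> powr p \<le> C * (\<Sum>j\<in>bars. stretch v x h j powr p)"
        by (simp add: C_def mult.assoc)
      then have "norm h powr p * norm ?\<Delta> powr p / norm h powr (p + b)
          \<le> C * (\<Sum>j\<in>bars. stretch v x h j powr p) / norm h powr (p + b)"
        by (rule divide_right_mono) simp
      then have "norm ?\<Delta> powr p / norm h powr b
          \<le> C * (\<Sum>j\<in>bars. stretch v x h j powr p / norm h powr (p + b))"
        using h(2) by (simp add: powr_add sum_divide_distrib[symmetric])
      then show ?thesis
        using True C by (simp add: F_def ennreal_mult'[symmetric] sum_ennreal ennreal_leI)
    qed (auto simp: indicator_def)
    have bar: "(\<integral>\<^sup>+x. (\<integral>\<^sup>+h. F j x h \<partial>lborel) \<partial>lborel) \<le> ennreal (4 powr (p + b)) * proj_energy b p D v"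
      if "j \<in> bars" for j
    proof (cases j)
      case (Pair \<alpha> S)
      show ?thesis
        using bar_energy_le[OF adm p b, of \<alpha> S] bars_bounds[of \<alpha> S] that
        unfolding F_def stretch_def Pair prod.case by blast
    qed
    have "second_energy b p D v \<le> (\<integral>\<^sup>+x. (\<integral>\<^sup>+h. ennreal C * (\<Sum>j\<in>bars. F j x h) \<partial>lborel) \<partial>lborel)"
      unfolding second_energy_def by (intro nn_integral_mono point)
    also have "\<dots> = ennreal C * (\<Sum>j\<in>bars. (\<integral>\<^sup>+x. (\<integral>\<^sup>+h. F j x h \<partial>lborel) \<partial>lborel))"
      by (simp add: nn_integral_cmult nn_integral_sum)
    also have "\<dots> \<le> ennreal C * (\<Sum>j\<in>?bars. ennreal (4 powr (p + b)) * proj_energy b p D v)"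
      by (intro mult_left_mono sum_mono bar) auto
    also have "\<dots> = ennreal (C * (card ?bars * 4 powr (p + b))) * proj_energy b p D v"
      using C by (simp add: ennreal_mult ennreal_of_nat_eq_real_of_nat mult.assoc)
    finally show "second_energy b p D v
        \<le> ennreal (C * (card ?bars * 4 powr (p + b))) * proj_energy b p D v" .
  qed
qed

subsection \<open>Absorption of the first differences\<close>

lemma nn_integral_double:
  fixes f :: "real ^ 'n::finite \<Rightarrow> ennreal"
  assumes [measurable]: "f \<in> borel_measurable borel"
  shows "(\<integral>\<^sup>+h. f (2 *\<^sub>R h) \<partial>lborel) = ennreal (2 powr - real CARD('n)) * (\<integral>\<^sup>+h. f h \<partial>lborel)"
proof -
  have "diag (\<chi> i. 2) h = 2 *\<^sub>R h" for h :: "real ^ 'n"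
    by (simp add: diag_def vec_eq_iff)
  then have "(\<integral>\<^sup>+h. f h \<partial>lborel) = ennreal (2 ^ CARD('n)) * (\<integral>\<^sup>+h. f (2 *\<^sub>R h) \<partial>lborel)"
    using nn_integral_diag[OF assms, of "\<chi> i. 2"] by simp
  then have "ennreal (2 powr - real CARD('n)) * (\<integral>\<^sup>+h. f h \<partial>lborel)
      = ennreal (2 powr - real CARD('n) * 2 ^ CARD('n)) * (\<integral>\<^sup>+h. f (2 *\<^sub>R h) \<partial>lborel)"
    by (simp add: ennreal_mult mult.assoc del: ennreal_power)
  also have "(2::real) powr - real CARD('n) * 2 ^ CARD('n) = 1"
    by (simp add: powr_minus powr_realpow)
  finally show ?thesis by simp
qed

text \<open>Each difference is at most \<open>2 * B\<close> and vanishes unless \<open>x\<close> or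
  \<open>x + h\<close> lies in a fixed ball; away from the origin the kernel is integrable because
  \<open>b > d\<close>.\<close>

lemma cone_energy_finite:
  fixes v :: "real ^ 'n::finite \<Rightarrow> real ^ 'n"
  assumes adm: "admissible D v" and p: "0 < p" and b: "real CARD('n) < b" and e: "0 < e"
  shows "cone_energy b p D v e < \<infinity>"
proof -
  obtain B R where B: "\<And>x. norm (v x) \<le> B" and R: "\<And>x. v x \<noteq> 0 \<Longrightarrow> norm x \<le> R"
    using adm by (auto simp: admissible_def)
  let ?A = "cball (0 :: real ^ 'n) R"
  let ?t = "\<lambda>h :: real ^ 'n. ennreal (norm h powr (- b)) * indicator {h. e < norm h} h"
  have B0: "0 \<le> B" using B[of 0] norm_ge_zero order_trans by blast
  have point: "ennreal (norm (v (x + h) - v x) powr p / norm h powr b)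
        * indicator {h \<in> cone 2. e < norm h} h * indicator D x
      \<le> ennreal ((2 * B) powr p) * (indicator ?A (x + h) + indicator ?A x) * ?t h" for x h
  proof (cases "h \<in> cone 2 \<and> e < norm h \<and> x \<in> D \<and> v (x + h) - v x \<noteq> 0")
    case True
    have "norm (v (x + h) - v x) \<le> 2 * B"
      using norm_triangle_ineq4[of "v (x + h)" "v x"] B[of x] B[of "x + h"] by simp
    then have "norm (v (x + h) - v x) powr p / norm h powr b \<le> (2 * B) powr p * norm h powr (- b)"
      using p by (simp add: powr_minus divide_inverse powr_mono2 mult_right_mono)
    then have "ennreal (norm (v (x + h) - v x) powr p / norm h powr b)
        \<le> ennreal ((2 * B) powr p) * 1 * ?t h"
      using True by (simp add: ennreal_mult'[symmetric] ennreal_leI)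
    also have "\<dots> \<le> ennreal ((2 * B) powr p) * (indicator ?A (x + h) + indicator ?A x) * ?t h"
    proof (intro mult_right_mono mult_left_mono)
      have "v (x + h) \<noteq> 0 \<or> v x \<noteq> 0" using True by auto
      then show "1 \<le> (indicator ?A (x + h) + indicator ?A x :: ennreal)"
        using R by (auto simp: indicator_def)
    qed auto
    finally show ?thesis using True by simp
  next
    case False
    then show ?thesis by (cases "v (x + h) = v x") (auto simp: indicator_def)
  qed
  have [measurable]: "?A \<in> sets borel" by simp
  define P where "P = ennreal ((2 * B) powr p)"
  define m where "m = emeasure lborel ?A"
  have m: "m < \<infinity>" unfolding m_def by (rule emeasure_lborel_cball_finite)
  have "cone_energy b p D v e
      \<le> (\<integral>\<^sup>+x. (\<integral>\<^sup>+h. P * (indicator ?A (x + h) + indicator ?A x) * ?t h \<partial>lborel) \<partial>lborel)"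
    unfolding cone_energy_def P_def by (intro nn_integral_mono point)
  \<comment> \<open>Integrating in \<open>x\<close> first gives the constant \<open>m + m\<close>
    for every \<open>h\<close>, twice the volume of the ball.\<close>
  also have "\<dots> = (\<integral>\<^sup>+h. (\<integral>\<^sup>+x. P * (indicator ?A (x + h) + indicator ?A x) * ?t h \<partial>lborel) \<partial>lborel)"
    by (rule lborel_pair.Fubini') simp
  also have "\<dots> = (\<integral>\<^sup>+h. P * (m + m) * ?t h \<partial>lborel)"
  proof (rule nn_integral_cong)
    fix h
    have "(\<integral>\<^sup>+x. indicator ?A (x + h) \<partial>lborel) = m"
      using nn_integral_translate[of "indicator ?A" h] by (simp add: m_def)
    then show "(\<integral>\<^sup>+x. P * (indicator ?A (x + h) + indicator ?A x) * ?t h \<partial>lborel) = P * (m + m) * ?t h"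
      by (simp add: nn_integral_multc nn_integral_cmult nn_integral_add m_def)
  qed
  also have "\<dots> = P * (m + m) * (\<integral>\<^sup>+h. ?t h \<partial>lborel)"
    by (rule nn_integral_cmult) simp
  also have "\<dots> < \<infinity>"
    using nn_integral_norm_powr_tail[of b e, where 'a = "real ^ 'n"] b e m
    by (simp add: ennreal_mult_less_top P_def)
  finally show ?thesis .
qed

text \<open>Twice the first difference is the difference over the doubled step minus the second
  difference. The gain \<open>2 powr (- p)\<close> drives the absorption; \<open>\<eta>\<close>
  stays free so that the splitting spoils only part of it.\<close>

lemma first_difference_powr_le:
  fixes a b c :: "'a::real_normed_vector"
  assumes "0 < \<eta>" "0 < p"
  shows "norm (b - a) powr p \<le> 2 powr (- p) * ((1 + \<eta>) powr p * norm (c - a) powr p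
           + (1 + 1 / \<eta>) powr p * norm (a - 2 *\<^sub>R b + c) powr p)"
proof -
  have "2 *\<^sub>R (b - a) = (c - a) - (a - 2 *\<^sub>R b + c)" by (simp add: algebra_simps scaleR_2)
  then have "norm (2 *\<^sub>R (b - a)) \<le> norm (c - a) + norm (a - 2 *\<^sub>R b + c)"
    using norm_triangle_ineq4[of "c - a" "a - 2 *\<^sub>R b + c"] by simp
  then have "(2 * norm (b - a)) powr p \<le> (norm (c - a) + norm (a - 2 *\<^sub>R b + c)) powr p"
    using assms by (intro powr_mono2) auto
  also have "\<dots> \<le> (1 + \<eta>) powr p * norm (c - a) powr p
      + (1 + 1 / \<eta>) powr p * norm (a - 2 *\<^sub>R b + c) powr p"
    using assms by (intro powr_add_le_weighted) auto
  finally have "2 powr (- p) * (2 powr p * norm (b - a) powr p)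
      \<le> 2 powr (- p) * ((1 + \<eta>) powr p * norm (c - a) powr p
      + (1 + 1 / \<eta>) powr p * norm (a - 2 *\<^sub>R b + c) powr p)"
    by (intro mult_left_mono) (simp_all add: powr_mult)
  moreover have "2 powr (- p) * (2 powr p * norm (b - a) powr p) = norm (b - a) powr p"
    by (simp add: powr_minus)
  ultimately show ?thesis by simp
qed

lemma ennreal_le_linear_combination:
  assumes "x \<le> k * y + l * z" "0 \<le> k" "0 \<le> l" "0 \<le> y" "0 \<le> z"
  shows "ennreal x \<le> ennreal k * ennreal y + ennreal l * ennreal z"
  using assms by (simp add: ennreal_mult[symmetric] ennreal_plus[symmetric] ennreal_leI del: ennreal_plus)

text \<open>Rescaling the doubled step costs \<open>2 powr (b - d) = 2 powr (s * p)\<close>, which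
  the gain \<open>2 powr (- p)\<close> outweighs since \<open>s < 1\<close>. Finiteness of the
  truncated energy permits the subtraction, and the constant does not depend on
  \<open>e\<close>.\<close>

lemma cone_energy_absorb:
  fixes s p :: real
  assumes s: "0 < s" "s < 1" and p: "1 < p" and b: "b = real CARD('n) + s * p"
  shows "\<exists>C>0. \<forall>D (v :: real ^ 'n::finite \<Rightarrow> real ^ 'n) e. admissible D v \<longrightarrow> 0 < e \<longrightarrow>
           cone_energy b p D v e \<le> ennreal C * second_energy b p D v"
proof -
  \<comment> \<open>The choice of \<open>\<eta>\<close> spends half of the surplus exponent
    \<open>(1 - s) * p\<close>; the other half makes the absorbed factor \<open>\<kappa>\<close>
    smaller than 1.\<close>
  define \<kappa> where "\<kappa> = 2 powr (- ((1 - s) / 2 * p))"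
  define \<eta> where "\<eta> = 2 powr ((1 - s) / 2) - (1 :: real)"
  define L where "L = 2 powr (- p) * (1 + 1 / \<eta>) powr p"
  have \<kappa>: "0 < \<kappa>" "\<kappa> < 1" using s p by (auto simp: \<kappa>_def powr_less_one)
  have \<eta>: "0 < \<eta>" using s by (simp add: \<eta>_def)
  have "0 < 1 + 1 / \<eta>" using \<eta> by (intro add_pos_pos) auto
  then have L: "0 < L" by (simp add: L_def)
  have \<kappa>_eq: "2 powr (- p) * (1 + \<eta>) powr p * 2 powr b * 2 powr - real CARD('n) = \<kappa>"
  proof -
    have "(1 + \<eta>) powr p = 2 powr ((1 - s) / 2 * p)"
      by (simp add: \<eta>_def powr_powr)
    then have "2 powr (- p) * (1 + \<eta>) powr p * 2 powr b * 2 powr - real CARD('n)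
        = 2 powr (- p + (1 - s) / 2 * p + b + - real CARD('n))"
      by (simp only: powr_add)
    also have "- p + (1 - s) / 2 * p + b + - real CARD('n) = - ((1 - s) / 2 * p)"
      by (simp add: b field_simps)
    finally show ?thesis by (simp only: \<kappa>_def)
  qed
  show ?thesis
  proof (intro exI[of _ "L / (1 - \<kappa>)"] conjI allI impI)
    show "0 < L / (1 - \<kappa>)" using \<kappa> L by simp
    fix D and v :: "real ^ 'n \<Rightarrow> real ^ 'n" and e :: real
    assume adm: "admissible D v" and e: "0 < e"
    then have [measurable]: "D \<in> sets borel" "v \<in> borel_measurable borel"
      by (auto simp: admissible_def)
    have [measurable]: "{h \<in> cone 2. e < norm h} \<in> sets (borel :: (real ^ 'n) measure)" by measurable
    define F where "F x h = ennreal (norm (v (x + h) - v x) powr p / norm h powr b)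
        * indicator {h \<in> cone 2. e < norm h} h * indicator D x" for x h
    define G where "G x h = ennreal (norm (v x - 2 *\<^sub>R v (x + h) + v (x + 2 *\<^sub>R h)) powr p / norm h powr b)
        * indicator (cone 2) h * indicator D x" for x h
    have [measurable]: "case_prod F \<in> borel_measurable (borel \<Otimes>\<^sub>M borel)"
      unfolding F_def by simp
    have [measurable]: "case_prod G \<in> borel_measurable (borel \<Otimes>\<^sub>M borel)"
      unfolding G_def by simp
    let ?k = "2 powr (- p) * (1 + \<eta>) powr p * 2 powr b"
    have point: "F x h \<le> ennreal ?k * F x (2 *\<^sub>R h) + ennreal L * G x h" for x h
    proof (cases "h \<in> cone 2 \<and> e < norm h \<and> x \<in> D")
      case True
      \<comment> \<open>The truncated cone is stable under doubling, so the term at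
        \<open>2 *\<^sub>R h\<close> belongs to the same energy.\<close>
      have h: "2 *\<^sub>R h \<in> cone 2" "e < norm (2 *\<^sub>R h)" "0 < norm h"
        using True e by (auto simp: cone_def)
      have "norm (v (x + h) - v x) powr p / norm h powr b \<le>
          (2 powr (- p) * ((1 + \<eta>) powr p * norm (v (x + 2 *\<^sub>R h) - v x) powr p
           + (1 + 1 / \<eta>) powr p * norm (v x - 2 *\<^sub>R v (x + h) + v (x + 2 *\<^sub>R h)) powr p)) / norm h powr b"
        using \<eta> p by (intro divide_right_mono first_difference_powr_le) auto
      also have "\<dots> = ?k * (norm (v (x + 2 *\<^sub>R h) - v x) powr p / norm (2 *\<^sub>R h) powr b)
          + L * (norm (v x - 2 *\<^sub>R v (x + h) + v (x + 2 *\<^sub>R h)) powr p / norm h powr b)"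
        using h(3) by (simp add: L_def powr_mult field_simps)
      finally have "ennreal (norm (v (x + h) - v x) powr p / norm h powr b)
        \<le> ennreal ?k * ennreal (norm (v (x + 2 *\<^sub>R h) - v x) powr p / norm (2 *\<^sub>R h) powr b)
          + ennreal L * ennreal (norm (v x - 2 *\<^sub>R v (x + h) + v (x + 2 *\<^sub>R h)) powr p / norm h powr b)"
        using L by (intro ennreal_le_linear_combination) simp_all
      moreover have "h \<in> {h \<in> cone 2. e < norm h}" "2 *\<^sub>R h \<in> {h \<in> cone 2. e < norm h}"
        using True h by blast+
      moreover have "h \<in> cone 2" "x \<in> D" using True by blast+
      ultimately show ?thesis
        unfolding F_def G_def by (simp only: indicator_simps mult_1_right)
    next
      case False
      then have "F x h = 0" by (auto simp: F_def)
      then show ?thesis by simp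
    qed
    have E: "cone_energy b p D v e = (\<integral>\<^sup>+x. (\<integral>\<^sup>+h. F x h \<partial>lborel) \<partial>lborel)"
      by (simp add: cone_energy_def F_def)
    have "cone_energy b p D v e
        \<le> (\<integral>\<^sup>+x. (\<integral>\<^sup>+h. ennreal ?k * F x (2 *\<^sub>R h) + ennreal L * G x h \<partial>lborel) \<partial>lborel)"
      unfolding E by (intro nn_integral_mono point)
    also have "\<dots> = ennreal ?k * (\<integral>\<^sup>+x. (\<integral>\<^sup>+h. F x (2 *\<^sub>R h) \<partial>lborel) \<partial>lborel)
        + ennreal L * second_energy b p D v"
      by (simp add: nn_integral_add nn_integral_cmult second_energy_def G_def del: ennreal_mult)
    also have "(\<integral>\<^sup>+x. (\<integral>\<^sup>+h. F x (2 *\<^sub>R h) \<partial>lborel) \<partial>lborel)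
        = ennreal (2 powr - real CARD('n)) * cone_energy b p D v e"
      unfolding E by (subst nn_integral_double) (simp_all add: nn_integral_cmult)
    also have "ennreal ?k * \<dots> = ennreal \<kappa> * cone_energy b p D v e"
      by (simp add: \<kappa>_eq[symmetric] ennreal_mult mult.assoc)
    finally have le: "cone_energy b p D v e
        \<le> ennreal \<kappa> * cone_energy b p D v e + ennreal L * second_energy b p D v" .
    have fin: "cone_energy b p D v e < \<infinity>"
      using adm e p s by (intro cone_energy_finite) (auto simp: b)
    show "cone_energy b p D v e \<le> ennreal (L / (1 - \<kappa>)) * second_energy b p D v"
    proof (cases "second_energy b p D v = \<infinity>")
      case True
      then show ?thesis using \<kappa> L by (simp add: ennreal_mult_top)
    next
      case False
      obtain X where X: "cone_energy b p D v e = ennreal X" "0 \<le> X"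
        using fin by (cases "cone_energy b p D v e") auto
      obtain Y where Y: "second_energy b p D v = ennreal Y" "0 \<le> Y"
        using False by (cases "second_energy b p D v") auto
      have "ennreal X \<le> ennreal (\<kappa> * X + L * Y)"
        using le X Y \<kappa> L by (simp add: ennreal_mult ennreal_plus)
      then have "X \<le> \<kappa> * X + L * Y"
        using X Y \<kappa> L by (subst (asm) ennreal_le_iff) auto
      then have "X \<le> L / (1 - \<kappa>) * Y"
        using \<kappa> by (simp add: field_simps)
      then show ?thesis using X Y \<kappa> L by (simp add: ennreal_mult[symmetric] ennreal_leI)
    qed
  qed
qed

text \<open>Monotone convergence, in the inner and then the outer integral, along truncation radii
  \<open>r n\<close> decreasing to 0. It removes the truncation from a bound that is uniform in
  \<open>e\<close>.\<close>

lemma cone_energy_SUP: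
  fixes v :: "real ^ 'n::finite \<Rightarrow> real ^ 'n"
  assumes adm: "admissible D v" and le: "\<And>e. 0 < e \<Longrightarrow> cone_energy b p D v e \<le> K"
  shows "cone_energy b p D v 0 \<le> K"
proof -
  have [measurable]: "D \<in> sets borel" "v \<in> borel_measurable borel"
    using adm by (auto simp: admissible_def)
  have [measurable]: "{h \<in> cone 2. e < norm h} \<in> sets (borel :: (real ^ 'n) measure)" for e by measurable
  define F where "F e x h = ennreal (norm (v (x + h) - v x) powr p / norm h powr b)
      * indicator {h \<in> cone 2. e < norm h} h * indicator D x" for e x h
  have [measurable]: "case_prod (F e) \<in> borel_measurable (borel \<Otimes>\<^sub>M borel)" for e
    unfolding F_def by simp
  have mono: "F e x h \<le> F e' x h" if "e' \<le> e" for e e' x h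
    using that by (auto simp: F_def indicator_def)
  have energy: "cone_energy b p D v e = (\<integral>\<^sup>+x. (\<integral>\<^sup>+h. F e x h \<partial>lborel) \<partial>lborel)" for e
    by (simp only: cone_energy_def F_def)
  define r where "r n = inverse (real (Suc n))" for n
  have r: "0 < r n" for n by (simp add: r_def)
  have inc: "r n \<le> r m" if "m \<le> n" for m n
    using that by (simp add: r_def)
  have sup: "F 0 x h \<le> (SUP n. F (r n) x h)" for x h
  proof (cases "0 < norm h")
    case True
    then obtain n where "r n < norm h" unfolding r_def using reals_Archimedean by blast
    then have "F 0 x h = F (r n) x h"
      using True by (auto simp: F_def indicator_def)
    also have "\<dots> \<le> (SUP n. F (r n) x h)" by (rule SUP_upper) simp
    finally show ?thesis .
  qed (auto simp: F_def)
  have "cone_energy b p D v 0 \<le> (\<integral>\<^sup>+x. (\<integral>\<^sup>+h. (SUP n. F (r n) x h) \<partial>lborel) \<partial>lborel)"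
    unfolding energy by (intro nn_integral_mono sup)
  also have "\<dots> = (\<integral>\<^sup>+x. (SUP n. (\<integral>\<^sup>+h. F (r n) x h \<partial>lborel)) \<partial>lborel)"
  proof (rule nn_integral_cong, rule nn_integral_monotone_convergence_SUP)
    show "incseq (\<lambda>n. F (r n) x)" for x
      unfolding incseq_def le_fun_def by (blast intro: mono inc)
  qed measurable
  also have "\<dots> = (SUP n. (\<integral>\<^sup>+x. (\<integral>\<^sup>+h. F (r n) x h \<partial>lborel) \<partial>lborel))"
  proof (rule nn_integral_monotone_convergence_SUP)
    show "incseq (\<lambda>n x. \<integral>\<^sup>+h. F (r n) x h \<partial>lborel)"
      unfolding incseq_def le_fun_def by (blast intro: nn_integral_mono mono inc)
  qed measurable
  also have "\<dots> \<le> K"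
    unfolding energy[symmetric] by (intro SUP_least le r)
  finally show ?thesis .
qed

subsection \<open>Reduction to cone differences\<close>

lemma vec_nth_measurable [measurable (raw)]:
  fixes f :: "'a \<Rightarrow> real ^ 'n::finite"
  assumes "f \<in> borel_measurable M"
  shows "(\<lambda>x. f x $ i) \<in> borel_measurable M"
  using measurable_compose[OF assms, of "\<lambda>v. v $ i" borel]
  by (simp add: borel_measurable_continuous_onI continuous_intros)

text \<open>
  Averaging over \<open>h \<in> |g| [4, 5]\<^sup>d\<close> compares \<open>x\<close> and \<open>x + g\<close> through \<open>x + h\<close>.  Both \<open>h\<close> and \<open>h - g\<close> then
  have all coordinates in \<open>|g| [3, 6]\<close>, hence lie in \<open>cone 2\<close>.
\<close>

definition averaging_kernel :: "real \<Rightarrow> real ^ 'n::finite \<Rightarrow> real ^ 'n \<Rightarrow> ennreal" where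
  "averaging_kernel b g h =
     (if 0 < norm g \<and> (\<forall>i. 3 * norm g \<le> h $ i \<and> h $ i \<le> 6 * norm g)
      then ennreal (norm g powr - (b + real CARD('n))) else 0)"

lemma averaging_kernel_measurable [measurable]:
  "case_prod (averaging_kernel b :: real ^ 'n::finite \<Rightarrow> real ^ 'n \<Rightarrow> ennreal)
    \<in> borel_measurable (borel \<Otimes>\<^sub>M borel)"
proof -
  have le: "Measurable.pred M (\<lambda>z. f z \<le> g z)"
    if "f \<in> borel_measurable M" "g \<in> borel_measurable M"
    for M and f g :: "(real ^ 'n) \<times> (real ^ 'n) \<Rightarrow> real"
    using borel_measurable_le[OF that] by (simp add: pred_def)
  have [measurable]: "Measurable.pred (borel \<Otimes>\<^sub>M borel)
      (\<lambda>z :: (real ^ 'n) \<times> (real ^ 'n). \<forall>i. 3 * norm (fst z) \<le> snd z $ i \<and> snd z $ i \<le> 6 * norm (fst z))"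
    by (intro pred_intros_countable(1) pred_intros_logic(3) le) measurable
  show ?thesis unfolding averaging_kernel_def case_prod_beta by (intro measurable_If) simp_all
qed

lemma powr_minus_add_power:
  fixes r :: real
  assumes "0 < r"
  shows "r powr - (b + real n) * r ^ n = 1 / r powr b"
proof -
  have "r powr - (b + real n) * r ^ n = r powr (- (b + real n) + real n)"
    using assms by (simp only: powr_add powr_realpow)
  then show ?thesis by (simp add: powr_minus_divide)
qed

text \<open>For fixed \<open>h\<close>, a nonzero value forces
  \<open>norm h / (6 * d) \<le> norm g \<le> norm h\<close>. The weight is then of order
  \<open>norm h powr - (b + d)\<close> on a ball of volume of order
  \<open>norm h ^ d\<close>.\<close>

lemma averaging_kernel_integral:
  fixes b :: real
  assumes b: "0 < b"
  shows "\<exists>C>0. \<forall>h :: real ^ 'n::finite. (\<integral>\<^sup>+g. averaging_kernel b g h \<partial>lborel)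
           \<le> ennreal (C / norm h powr b) * indicator (cone 2) h"
proof -
  let ?d = "real CARD('n)"
  obtain c where c: "c > 0"
    "\<And>r. r \<ge> 0 \<Longrightarrow> emeasure lborel (cball (0 :: real ^ 'n) r) \<le> ennreal (c * r ^ CARD('n))"
    using emeasure_cball_le[of "0 :: real ^ 'n"] by auto
  define m where "m = (6 * ?d) powr (b + ?d)"
  have m: "0 < m" by (simp add: m_def)
  show ?thesis
  proof (intro exI[of _ "m * c"] conjI allI)
    show "0 < m * c" using m c by simp
    fix h :: "real ^ 'n"
    show "(\<integral>\<^sup>+g. averaging_kernel b g h \<partial>lborel) \<le> ennreal (m * c / norm h powr b) * indicator (cone 2) h"
    proof (cases "h \<in> cone 2")
      case True
      then have h: "0 < norm h" by (rule cone_norm_pos)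
      have bound: "averaging_kernel b g h \<le> ennreal (m * norm h powr - (b + ?d)) * indicator (cball (0 :: real ^ 'n) (norm h)) g" for g
      proof (cases "0 < norm g \<and> (\<forall>i. 3 * norm g \<le> h $ i \<and> h $ i \<le> 6 * norm g)")
        case T: True
        obtain i :: 'n where True by simp
        have "3 * norm g \<le> norm h"
          using T component_le_norm_cart[of h i] by (smt (verit))
        then have g: "norm g \<le> norm h" using norm_ge_zero[of g] by linarith
        have "norm h \<le> (\<Sum>i\<in>UNIV. \<bar>h $ i\<bar>)" by (rule norm_le_l1_cart)
        also have "\<dots> \<le> (\<Sum>i\<in>(UNIV :: 'n set). 6 * norm g)"
        proof (rule sum_mono)
          fix i
          show "\<bar>h $ i\<bar> \<le> 6 * norm g" using T by (smt (verit))
        qed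
        finally have "norm h \<le> 6 * ?d * norm g" by (simp add: mult_ac)
        then have "norm h powr (b + ?d) \<le> (6 * ?d * norm g) powr (b + ?d)"
          using b by (intro powr_mono2) auto
        then have "norm h powr (b + ?d) \<le> m * norm g powr (b + ?d)"
          unfolding m_def by (subst powr_mult[symmetric])
        then have "norm g powr - (b + ?d) \<le> m * norm h powr - (b + ?d)"
          using T h unfolding powr_minus by (simp add: field_simps)
        then show ?thesis using T g by (simp add: averaging_kernel_def ennreal_leI)
      next
        case False
        then show ?thesis by (simp only: averaging_kernel_def if_False) simp
      qed
      have "(\<integral>\<^sup>+g. averaging_kernel b g h \<partial>lborel)
          \<le> (\<integral>\<^sup>+g. ennreal (m * norm h powr - (b + ?d)) * indicator (cball (0 :: real ^ 'n) (norm h)) g \<partial>lborel)"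
        by (intro nn_integral_mono bound)
      also have "\<dots> = ennreal (m * norm h powr - (b + ?d)) * emeasure lborel (cball (0 :: real ^ 'n) (norm h))"
        by (rule nn_integral_cmult_indicator) simp
      also have "\<dots> \<le> ennreal (m * norm h powr - (b + ?d)) * ennreal (c * norm h ^ CARD('n))"
        by (intro mult_left_mono c(2)) simp_all
      also have "\<dots> = ennreal (m * norm h powr - (b + ?d) * (c * norm h ^ CARD('n)))"
        using m by (intro ennreal_mult'[symmetric]) simp
      also have "m * norm h powr - (b + ?d) * (c * norm h ^ CARD('n))
          = m * c * (norm h powr - (b + ?d) * norm h ^ CARD('n))"
        by simp
      also have "\<dots> = m * c / norm h powr b"
        using h by (simp only: powr_minus_add_power) simp
      finally show ?thesis using True by simp
    next
      case False
      have "averaging_kernel b g h = 0" for g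
      proof -
        have "h \<in> cone 2" if T: "0 < norm g" "\<forall>i. 3 * norm g \<le> h $ i \<and> h $ i \<le> 6 * norm g"
          unfolding cone_def
        proof (intro CollectI allI conjI)
          fix i j
          show "0 < h $ i" using T(1) spec[OF T(2), of i] by linarith
          show "h $ i \<le> 2 * h $ j" using spec[OF T(2), of i] spec[OF T(2), of j] by linarith
        qed
        then show ?thesis using False by (auto simp: averaging_kernel_def)
      qed
      then show ?thesis by simp
    qed
  qed
qed

lemma emeasure_cbox_cube:
  fixes r :: real
  assumes "0 \<le> r"
  shows "emeasure lborel (cbox (\<chi> i. t) (\<chi> i. t + r) :: (real ^ 'n::finite) set) = ennreal (r ^ CARD('n))"
proof -
  let ?a = "(\<chi> i. t) :: real ^ 'n" and ?b = "(\<chi> i. t + r) :: real ^ 'n"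
  have B: "?a \<bullet> b \<le> ?b \<bullet> b" "(?b - ?a) \<bullet> b = r" if "b \<in> Basis" for b
    using that assms by (auto simp: Basis_vec_def inner_axis)
  have "(\<Prod>b\<in>(Basis :: (real ^ 'n) set). (?b - ?a) \<bullet> b) = (\<Prod>b\<in>(Basis :: (real ^ 'n) set). r)"
    by (rule prod.cong) (simp_all only: B)
  then show ?thesis
    using B by (simp add: emeasure_lborel_cbox_eq)
qed

text \<open>The increments \<open>h\<close> from \<open>x\<close> and \<open>h - g\<close> from
  \<open>x + g\<close> reach the same point, so the triangle inequality bounds the difference over
  \<open>g\<close> by two cone differences. Integrating out \<open>g\<close> turns the averaging
  kernel into a multiple of \<open>norm h powr - b\<close>.\<close>

lemma full_energy_le_cone_energy:
  fixes b p :: real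
  assumes p: "0 < p" and b: "0 < b"
  shows "\<exists>C>0. \<forall>D (v :: real ^ 'n::finite \<Rightarrow> real ^ 'n). admissible D v \<longrightarrow>
           full_energy b p D v \<le> ennreal C * cone_energy b p D v 0"
proof -
  let ?d = "real CARD('n)"
  let ?H = "averaging_kernel b :: real ^ 'n \<Rightarrow> real ^ 'n \<Rightarrow> ennreal"
  obtain C where C: "0 < C"
      "\<And>h. (\<integral>\<^sup>+g. ?H g h \<partial>lborel) \<le> ennreal (C / norm h powr b) * indicator (cone 2) h"
    using averaging_kernel_integral[OF b, where 'n = 'n] by blast
  show ?thesis
  proof (intro exI[of _ "2 powr p * 2 * C"] conjI allI impI)
    show "0 < 2 powr p * 2 * C" using C by simp
    fix D and v :: "real ^ 'n \<Rightarrow> real ^ 'n"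
    assume "admissible D v"
    then have [measurable]: "D \<in> sets borel" "v \<in> borel_measurable borel"
      by (auto simp: admissible_def)
    define P where "P x h = ennreal (norm (v (x + h) - v x) powr p)" for x h
    have [measurable]: "case_prod P \<in> borel_measurable (borel \<Otimes>\<^sub>M borel)"
      unfolding P_def by measurable
    have point: "ennreal (norm (v (x + g) - v x) powr p / norm g powr b)
        \<le> ennreal (2 powr p) * ((\<integral>\<^sup>+h. ?H g h * P x h \<partial>lborel) + (\<integral>\<^sup>+h. ?H g h * P (x + g) h \<partial>lborel))" for x g
    proof (cases "g = 0")
      case False
      define r where "r = norm g"
      have r: "0 < r" using False by (simp add: r_def)
      let ?Q = "cbox (\<chi> i. 4 * r) (\<chi> i. 4 * r + r) :: (real ^ 'n) set"
      let ?A = "norm (v (x + g) - v x) powr p"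
      have Q: "ennreal (?A * r powr - (b + ?d)) * indicator ?Q h
          \<le> ennreal (2 powr p) * (?H g h * P x h + ?H g (h - g) * P (x + g) (h - g))" for h
      proof (cases "h \<in> ?Q")
        case True
        then have h: "4 * r \<le> h $ i" "h $ i \<le> 5 * r" for i by (auto simp: mem_box_cart)
        have g: "\<bar>g $ i\<bar> \<le> r" for i unfolding r_def by (rule component_le_norm_cart)
        have "3 * r \<le> h $ i \<and> h $ i \<le> 6 * r" for i using h[of i] r by linarith
        then have H1: "?H g h = ennreal (r powr - (b + ?d))" using r by (simp add: averaging_kernel_def r_def)
        have "3 * r \<le> (h - g) $ i \<and> (h - g) $ i \<le> 6 * r" for i
          using h[of i] g[of i] r unfolding vector_minus_component by linarith
        then have H2: "?H g (h - g) = ennreal (r powr - (b + ?d))" using r by (simp add: averaging_kernel_def r_def)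
        let ?X = "norm (v (x + h) - v x)" and ?Y = "norm (v (x + g + (h - g)) - v (x + g))"
        have "v (x + g) - v x = (v (x + h) - v x) - (v (x + g + (h - g)) - v (x + g))" by simp
        then have "norm (v (x + g) - v x) \<le> ?X + ?Y" using norm_triangle_ineq4 by metis
        then have "?A \<le> (?X + ?Y) powr p" using p by (intro powr_mono2) auto
        also have "\<dots> \<le> 2 powr p * (?X powr p + ?Y powr p)" using p by (intro powr_add_le) auto
        finally have "?A * r powr - (b + ?d) \<le> 2 powr p * (?X powr p + ?Y powr p) * r powr - (b + ?d)"
          by (intro mult_right_mono) simp_all
        then have "?A * r powr - (b + ?d)
            \<le> 2 powr p * (r powr - (b + ?d) * ?X powr p + r powr - (b + ?d) * ?Y powr p)"
          by (simp add: algebra_simps)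
        then have "ennreal (?A * r powr - (b + ?d))
            \<le> ennreal (2 powr p) * (ennreal (r powr - (b + ?d)) * ennreal (?X powr p)
               + ennreal (r powr - (b + ?d)) * ennreal (?Y powr p))"
          by (simp add: ennreal_mult[symmetric] ennreal_plus[symmetric] ennreal_leI del: ennreal_plus)
        then show ?thesis using True by (simp only: H1 H2 P_def indicator_simps mult_1_right)
      qed simp
      \<comment> \<open>The volume \<open>r ^ d\<close> of the cube compensates the additional
        exponent \<open>d\<close> in the weight of the kernel.\<close>
      have "r powr - (b + ?d) * r ^ CARD('n) = 1 / r powr b"
        using r by (rule powr_minus_add_power)
      then have "ennreal (?A / norm g powr b) = ennreal (?A * r powr - (b + ?d) * r ^ CARD('n))"
        by (simp add: r_def[symmetric] mult.assoc)
      also have "\<dots> = ennreal (?A * r powr - (b + ?d)) * emeasure lborel ?Q"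
        using r by (subst emeasure_cbox_cube) (simp_all add: ennreal_mult)
      also have "\<dots> = (\<integral>\<^sup>+h. ennreal (?A * r powr - (b + ?d)) * indicator ?Q h \<partial>lborel)"
        by (rule nn_integral_cmult_indicator[symmetric]) simp
      also have "\<dots> \<le> (\<integral>\<^sup>+h. ennreal (2 powr p) * (?H g h * P x h + ?H g (h - g) * P (x + g) (h - g)) \<partial>lborel)"
        by (intro nn_integral_mono Q)
      also have "\<dots> = ennreal (2 powr p) * ((\<integral>\<^sup>+h. ?H g h * P x h \<partial>lborel)
          + (\<integral>\<^sup>+h. ?H g (h - g) * P (x + g) (h - g) \<partial>lborel))"
        by (simp add: nn_integral_cmult nn_integral_add)
      also have "(\<integral>\<^sup>+h. ?H g (h - g) * P (x + g) (h - g) \<partial>lborel) = (\<integral>\<^sup>+h. ?H g h * P (x + g) h \<partial>lborel)"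
        using nn_integral_translate[of "\<lambda>h. ?H g h * P (x + g) h" "- g"] by simp
      finally show ?thesis .
    qed simp
    \<comment> \<open>The indicator sits at the base point of the increment, so the term based at
      \<open>x + g\<close> is a translate of the one based at \<open>x\<close>.\<close>
    define \<Phi> where "\<Phi> x g = (\<integral>\<^sup>+h. indicator D x * (?H g h * P x h) \<partial>lborel)" for x g
    have [measurable]: "case_prod \<Phi> \<in> borel_measurable (borel \<Otimes>\<^sub>M borel)"
      unfolding \<Phi>_def by measurable
    have \<Phi>: "\<Phi> x g = indicator D x * (\<integral>\<^sup>+h. ?H g h * P x h \<partial>lborel)" for x g
      unfolding \<Phi>_def by (rule nn_integral_cmult) simp
    have bound: "ennreal (norm (v (x + g) - v x) powr p / norm g powr b) * indicator D (x + g) * indicator D x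
        \<le> ennreal (2 powr p) * (\<Phi> x g + \<Phi> (x + g) g)" for x g
      using point[of x g] by (cases "x \<in> D"; cases "x + g \<in> D") (simp_all add: \<Phi>)
    have "full_energy b p D v
        \<le> (\<integral>\<^sup>+x. (\<integral>\<^sup>+g. ennreal (2 powr p) * (\<Phi> x g + \<Phi> (x + g) g) \<partial>lborel) \<partial>lborel)"
      unfolding full_energy_def by (intro nn_integral_mono bound)
    also have "\<dots> = ennreal (2 powr p) * ((\<integral>\<^sup>+x. (\<integral>\<^sup>+g. \<Phi> x g \<partial>lborel) \<partial>lborel)
        + (\<integral>\<^sup>+x. (\<integral>\<^sup>+g. \<Phi> (x + g) g \<partial>lborel) \<partial>lborel))"
      by (simp add: nn_integral_cmult nn_integral_add)
    \<comment> \<open>Translation in \<open>x\<close> for fixed \<open>g\<close> gives both terms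
      the same integral, whence the factor 2 in the constant.\<close>
    also have "(\<integral>\<^sup>+x. (\<integral>\<^sup>+g. \<Phi> (x + g) g \<partial>lborel) \<partial>lborel) = (\<integral>\<^sup>+g. (\<integral>\<^sup>+x. \<Phi> (x + g) g \<partial>lborel) \<partial>lborel)"
      by (rule lborel_pair.Fubini') measurable
    also have "\<dots> = (\<integral>\<^sup>+g. (\<integral>\<^sup>+x. \<Phi> x g \<partial>lborel) \<partial>lborel)"
      by (subst nn_integral_translate) auto
    also have "\<dots> = (\<integral>\<^sup>+x. (\<integral>\<^sup>+g. \<Phi> x g \<partial>lborel) \<partial>lborel)"
      by (rule lborel_pair.Fubini'[symmetric]) measurable
    also have "(\<integral>\<^sup>+x. (\<integral>\<^sup>+g. \<Phi> x g \<partial>lborel) \<partial>lborel) \<le> ennreal C * cone_energy b p D v 0"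
    proof -
      have inner: "(\<integral>\<^sup>+g. \<Phi> x g \<partial>lborel) \<le> (\<integral>\<^sup>+h. ennreal C * (ennreal (norm (v (x + h) - v x) powr p / norm h powr b)
        * indicator {h \<in> cone 2. 0 < norm h} h * indicator D x) \<partial>lborel)" for x
      proof -
        have "(\<integral>\<^sup>+g. \<Phi> x g \<partial>lborel) = (\<integral>\<^sup>+h. (\<integral>\<^sup>+g. indicator D x * (?H g h * P x h) \<partial>lborel) \<partial>lborel)"
          unfolding \<Phi>_def by (rule lborel_pair.Fubini'[symmetric]) measurable
        also have "\<dots> = (\<integral>\<^sup>+h. indicator D x * ((\<integral>\<^sup>+g. ?H g h \<partial>lborel) * P x h) \<partial>lborel)"
          by (simp add: nn_integral_cmult nn_integral_multc)
        also have "\<dots> \<le> (\<integral>\<^sup>+h. indicator D x * (ennreal (C / norm h powr b) * indicator (cone 2) h * P x h) \<partial>lborel)"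
          by (intro nn_integral_mono mult_left_mono mult_right_mono C(2)) simp_all
        also have "\<dots> = (\<integral>\<^sup>+h. ennreal C * (ennreal (norm (v (x + h) - v x) powr p / norm h powr b)
            * indicator {h \<in> cone 2. 0 < norm h} h * indicator D x) \<partial>lborel)"
        proof (rule nn_integral_cong)
          fix h :: "real ^ 'n"
          have ind: "indicator {h \<in> cone 2. 0 < norm h} h = (indicator (cone 2) h :: ennreal)"
            using cone_norm_pos[of h 2] by (auto simp: indicator_def)
          have val: "ennreal (C / norm h powr b) * P x h
              = ennreal C * ennreal (norm (v (x + h) - v x) powr p / norm h powr b)"
            using C(1) by (simp add: P_def ennreal_mult'[symmetric])
          have "indicator D x * (ennreal (C / norm h powr b) * indicator (cone 2) h * P x h)
              = (ennreal (C / norm h powr b) * P x h) * indicator (cone 2) h * indicator D x"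
            by (simp only: mult_ac)
          also have "\<dots> = ennreal C * (ennreal (norm (v (x + h) - v x) powr p / norm h powr b)
              * indicator {h \<in> cone 2. 0 < norm h} h * indicator D x)"
            by (simp only: val ind mult.assoc)
          finally show "indicator D x * (ennreal (C / norm h powr b) * indicator (cone 2) h * P x h)
              = ennreal C * (ennreal (norm (v (x + h) - v x) powr p / norm h powr b)
              * indicator {h \<in> cone 2. 0 < norm h} h * indicator D x)" .
        qed
        finally show ?thesis .
      qed
      have "(\<integral>\<^sup>+x. (\<integral>\<^sup>+g. \<Phi> x g \<partial>lborel) \<partial>lborel) \<le> (\<integral>\<^sup>+x. (\<integral>\<^sup>+h. ennreal C *
          (ennreal (norm (v (x + h) - v x) powr p / norm h powr b)
          * indicator {h \<in> cone 2. 0 < norm h} h * indicator D x) \<partial>lborel) \<partial>lborel)"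
        by (intro nn_integral_mono inner)
      also have "\<dots> = ennreal C * cone_energy b p D v 0"
        unfolding cone_energy_def by (simp add: nn_integral_cmult)
      finally show ?thesis .
    qed
    finally have "full_energy b p D v
        \<le> ennreal (2 powr p) * (ennreal C * cone_energy b p D v 0 + ennreal C * cone_energy b p D v 0)"
      by (simp add: mult_left_mono add_mono)
    also have "\<dots> = ennreal (2 powr p) * (2 * ennreal C) * cone_energy b p D v 0"
      by (simp only: mult_2 distrib_left distrib_right mult.assoc)
    also have "ennreal (2 powr p) * (2 * ennreal C) = ennreal (2 powr p * 2 * C)"
      using C(1) by (simp add: ennreal_mult mult.assoc)
    finally show "full_energy b p D v \<le> ennreal (2 powr p * 2 * C) * cone_energy b p D v 0" .
  qed
qed

subsection \<open>Epigraphs\<close>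

text \<open>A closed set of full measure is the whole space. This turns the essential supremum of
  the gradient into a pointwise bound.\<close>

lemma continuous_AE_le:
  fixes g :: "'a::euclidean_space \<Rightarrow> real"
  assumes "continuous_on UNIV g" "AE x in lborel. g x \<le> c"
  shows "g x \<le> c"
proof -
  have "closed {x. g x \<le> c}" using assms(1) by (intro closed_Collect_le) auto
  moreover have "AE x in lebesgue. x \<in> {x. g x \<le> c}"
    using assms(2) by (auto intro: AE_completion)
  ultimately show ?thesis using mem_closed_if_AE_lebesgue by blast
qed

text \<open>Continuity of the gradient upgrades the almost everywhere bound to every point, and the
  mean value inequality on the convex whole space gives the Lipschitz estimate.\<close>

lemma supporting_function_lipschitz:
  fixes f :: "real ^ 'n::finite \<Rightarrow> real"
  assumes "supporting_function k f" "grad_Linf f < ereal M"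
  shows "\<bar>f x - f y\<bar> \<le> M * norm (x - y)"
proof -
  obtain f' where f': "\<And>x. (f has_derivative blinfun_apply (f' x)) (at x)" "continuous_on UNIV f'"
    using assms(1) by (auto simp: supporting_function_def C1_on_def)
  \<comment> \<open>The Riesz representative of the derivative: it is continuous by construction,
    and uniqueness of derivatives identifies it with \<open>grad f\<close>.\<close>
  define g where "g x = (\<Sum>b\<in>Basis. blinfun_apply (f' x) b *\<^sub>R b)" for x
  have f'_eq: "blinfun_apply (f' x) h = h \<bullet> g x" for x h
    by (subst euclidean_representation[symmetric, of h])
       (simp add: g_def inner_sum_right blinfun.sum_right blinfun.scaleR_right mult.commute)
  have gderiv: "GDERIV f x :> g x" for x
    using f'(1)[of x] by (simp add: gderiv_def f'_eq[abs_def])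
  have grad: "grad f x = g x" for x
    unfolding grad_def
  proof (rule the_equality[where a = "g x"])
    show "GDERIV f x :> g x" by (rule gderiv)
  next
    fix D assume "GDERIV f x :> D"
    then have "(\<lambda>h. h \<bullet> D) = (\<lambda>h. h \<bullet> g x)"
      using gderiv[of x] unfolding gderiv_def by (rule has_derivative_unique)
    then show "D = g x"
      by (metis inner_commute vector_eq_rdot)
  qed
  have cont: "continuous_on UNIV g"
    unfolding g_def by (intro continuous_intros f'(2))
  have [measurable]: "g \<in> borel_measurable borel"
    using cont by (rule borel_measurable_continuous_onI)
  have "AE x in lborel. ereal (norm (grad f x)) \<le> grad_Linf f"
    unfolding grad_Linf_def by (rule esssup_AE)
  then have "AE x in lborel. norm (g x) \<le> M"
    using assms(2) by (auto simp: grad elim!: eventually_mono) (metis ereal_less_eq(3) less_imp_le order_trans)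
  then have le: "norm (g x) \<le> M" for x
    using continuous_AE_le[of "\<lambda>x. norm (g x)" M x] cont by (auto intro: continuous_intros)
  have "onorm (blinfun_apply (f' z)) \<le> M" for z
  proof (rule onorm_le)
    fix h
    have "\<bar>h \<bullet> g z\<bar> \<le> norm h * norm (g z)" by (rule Cauchy_Schwarz_ineq2)
    also have "\<dots> \<le> norm h * M" by (intro mult_left_mono le) simp
    finally show "norm (blinfun_apply (f' z) h) \<le> M * norm h" by (simp add: f'_eq mult.commute)
  qed
  then have "norm (f x - f y) \<le> M * norm (x - y)"
    using has_derivative_at_withinI[OF f'(1)]
    by (intro differentiable_bound[of UNIV f "\<lambda>x. blinfun_apply (f' x)"]) simp_all
  then show ?thesis by simp
qed

section \<open>The seminorms as energies of a zero extension\<close>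

lemma ennroot_le:
  assumes "0 < p" "0 < C" "a \<le> ennreal C * b"
  shows "ennroot p a \<le> ennreal (C powr (1 / p)) * ennroot p b"
proof (cases "b = top")
  case True
  then show ?thesis using assms by (simp add: ennroot_def ennreal_mult_top)
next
  case False
  then obtain y where y: "b = ennreal y" "0 \<le> y" by (cases b) auto
  then have "a \<le> ennreal (C * y)" using assms by (simp add: ennreal_mult)
  then obtain x where x: "a = ennreal x" "0 \<le> x" "x \<le> C * y"
    using y assms by (cases a) (auto simp: top_unique)
  have "x powr (1 / p) \<le> (C * y) powr (1 / p)" using x assms by (intro powr_mono2) auto
  then have "ennreal (x powr (1 / p)) \<le> ennreal (C powr (1 / p) * y powr (1 / p))"
    using y assms by (intro ennreal_leI) (simp add: powr_mult)
  then show ?thesis using x y by (simp add: ennroot_def ennreal_mult)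
qed

text \<open>Substitute \<open>y = x + g\<close>. Replacing \<open>u\<close> by a function measurable
  on the whole space justifies the translation, and both functions agree wherever the integrand
  counts.\<close>

lemma W_energy_eq_full_energy:
  fixes u v :: "real ^ 'n::finite \<Rightarrow> real ^ 'n"
  assumes [measurable]: "D \<in> sets borel" "v \<in> borel_measurable borel" and uv: "\<And>x. x \<in> D \<Longrightarrow> u x = v x"
  shows "W_energy s p D u = full_energy (real CARD('n) + s * p) p D v"
proof -
  let ?b = "real CARD('n) + s * p"
  have "W_energy s p D u = (\<integral>\<^sup>+x. (\<integral>\<^sup>+y. ennreal (norm (v x - v y) powr p / norm (x - y) powr ?b)
      * indicator D y \<partial>lborel) * indicator D x \<partial>lborel)"
    unfolding W_energy_def
  proof (rule nn_integral_cong)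
    fix x
    have "(\<integral>\<^sup>+y\<in>D. ennreal (norm (u x - u y) powr p / norm (x - y) powr ?b) \<partial>lborel)
       = (\<integral>\<^sup>+y\<in>D. ennreal (norm (v x - v y) powr p / norm (x - y) powr ?b) \<partial>lborel)" if "x \<in> D"
      by (rule nn_integral_cong) (use that uv in \<open>auto simp: indicator_def\<close>)
    then show "(\<integral>\<^sup>+y\<in>D. ennreal (norm (u x - u y) powr p / norm (x - y) powr ?b) \<partial>lborel) * indicator D x
       = (\<integral>\<^sup>+y\<in>D. ennreal (norm (v x - v y) powr p / norm (x - y) powr ?b) \<partial>lborel) * indicator D x"
      by (cases "x \<in> D") simp_all
  qed
  also have "\<dots> = full_energy ?b p D v"
    unfolding full_energy_def
  proof (rule nn_integral_cong)
    fix x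
    have "(\<integral>\<^sup>+y\<in>D. ennreal (norm (v x - v y) powr p / norm (x - y) powr ?b) \<partial>lborel)
      = (\<integral>\<^sup>+g. ennreal (norm (v (x + g) - v x) powr p / norm g powr ?b) * indicator D (x + g) \<partial>lborel)"
      using nn_integral_translate[of "\<lambda>y. ennreal (norm (v x - v y) powr p / norm (x - y) powr ?b) * indicator D y" x]
      by (simp add: add.commute norm_minus_commute)
    then show "(\<integral>\<^sup>+y\<in>D. ennreal (norm (v x - v y) powr p / norm (x - y) powr ?b) \<partial>lborel) * indicator D x
      = (\<integral>\<^sup>+g. ennreal (norm (v (x + g) - v x) powr p / norm g powr ?b) * indicator D (x + g) * indicator D x \<partial>lborel)"
      by (simp add: nn_integral_multc)
  qed
  finally show ?thesis .
qed

lemma X_energy_eq_proj_energy: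
  fixes u v :: "real ^ 'n::finite \<Rightarrow> real ^ 'n"
  assumes [measurable]: "D \<in> sets borel" "v \<in> borel_measurable borel" and uv: "\<And>x. x \<in> D \<Longrightarrow> u x = v x"
  shows "X_energy s p D u = proj_energy (real CARD('n) + s * p) p D v"
proof -
  let ?b = "real CARD('n) + s * p"
  \<comment> \<open>The normalization contributes \<open>norm (y - x) powr p\<close> to the
    denominator; on the diagonal both sides are 0.\<close>
  have eq: "\<bar>w \<bullet> ((x - y) /\<^sub>R norm (x - y))\<bar> powr p / norm (x - y) powr ?b
      = \<bar>w \<bullet> (y - x)\<bar> powr p / norm (y - x) powr (p + ?b)" for w x y :: "real ^ 'n"
  proof (cases "x = y")
    case False
    have "\<bar>w \<bullet> ((x - y) /\<^sub>R norm (x - y))\<bar> = \<bar>w \<bullet> (y - x)\<bar> / norm (y - x)"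
      by (simp add: inner_diff_right abs_mult norm_minus_commute abs_minus_commute divide_inverse mult.commute)
    then show ?thesis by (simp add: powr_divide powr_add norm_minus_commute)
  qed simp
  have "X_energy s p D u = (\<integral>\<^sup>+x. (\<integral>\<^sup>+y. ennreal (\<bar>(v y - v x) \<bullet> (y - x)\<bar> powr p / norm (y - x) powr (p + ?b))
      * indicator D y \<partial>lborel) * indicator D x \<partial>lborel)"
    unfolding X_energy_def eq
  proof (rule nn_integral_cong)
    fix x
    have "(\<integral>\<^sup>+y\<in>D. ennreal (\<bar>(u x - u y) \<bullet> (y - x)\<bar> powr p / norm (y - x) powr (p + ?b)) \<partial>lborel)
       = (\<integral>\<^sup>+y\<in>D. ennreal (\<bar>(v y - v x) \<bullet> (y - x)\<bar> powr p / norm (y - x) powr (p + ?b)) \<partial>lborel)" if "x \<in> D"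
      by (rule nn_integral_cong)
         (use that uv in \<open>auto simp: indicator_def inner_diff_left abs_minus_commute\<close>)
    then show "(\<integral>\<^sup>+y\<in>D. ennreal (\<bar>(u x - u y) \<bullet> (y - x)\<bar> powr p / norm (y - x) powr (p + ?b)) \<partial>lborel) * indicator D x
       = (\<integral>\<^sup>+y\<in>D. ennreal (\<bar>(v y - v x) \<bullet> (y - x)\<bar> powr p / norm (y - x) powr (p + ?b)) \<partial>lborel) * indicator D x"
      by (cases "x \<in> D") simp_all
  qed
  also have "\<dots> = proj_energy ?b p D v"
    unfolding proj_energy_def
  proof (rule nn_integral_cong)
    fix x
    have "(\<integral>\<^sup>+y\<in>D. ennreal (\<bar>(v y - v x) \<bullet> (y - x)\<bar> powr p / norm (y - x) powr (p + ?b)) \<partial>lborel)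
      = (\<integral>\<^sup>+g. ennreal (\<bar>(v (x + g) - v x) \<bullet> g\<bar> powr p / norm g powr (p + ?b)) * indicator D (x + g) \<partial>lborel)"
      using nn_integral_translate[of
          "\<lambda>y. ennreal (\<bar>(v y - v x) \<bullet> (y - x)\<bar> powr p / norm (y - x) powr (p + ?b)) * indicator D y" x]
      by (simp add: add.commute)
    then show "(\<integral>\<^sup>+y\<in>D. ennreal (\<bar>(v y - v x) \<bullet> (y - x)\<bar> powr p / norm (y - x) powr (p + ?b)) \<partial>lborel) * indicator D x
      = (\<integral>\<^sup>+g. ennreal (\<bar>(v (x + g) - v x) \<bullet> g\<bar> powr p / norm g powr (p + ?b)) * indicator D (x + g) * indicator D x \<partial>lborel)"
      by (simp add: nn_integral_multc)
  qed
  finally show ?thesis .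
qed

lemma C1_on_imp_continuous_on: "C1_on S u \<Longrightarrow> continuous_on S u"
  unfolding C1_on_def
  by (metis continuous_at_imp_continuous_on has_derivative_continuous)

text \<open>\<open>u\<close> is arbitrary outside the epigraph, so it is cut off there. Continuity
  on the open epigraph gives measurability, and compactness of the support gives the bounds on
  values and support.\<close>

lemma admissible_zero_extension:
  fixes u :: "real ^ 'n::finite \<Rightarrow> real ^ 'n"
  assumes f: "supporting_function k f" "grad_Linf f < ereal (1 / (4 * real CARD('n)))"
    and u: "u \<in> C1_c (epigraph_of k f)"
  shows "admissible (epigraph_of k f) (\<lambda>x. indicator (epigraph_of k f) x *\<^sub>R u x)"
proof -
  let ?D = "epigraph_of k f"
  have "continuous_on UNIV f"
    using f(1) by (auto simp: supporting_function_def intro: C1_on_imp_continuous_on)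
  then have "open ?D"
    unfolding epigraph_of_def by (intro open_Collect_less continuous_intros)
  then have D: "?D \<in> sets borel" by simp
  have cu: "continuous_on ?D u" and K: "compact (closure (support_on ?D u))" "closure (support_on ?D u) \<subseteq> ?D"
    using u by (auto simp: C1_c_def intro: C1_on_imp_continuous_on)
  have supp: "x \<in> closure (support_on ?D u)" if "indicator ?D x *\<^sub>R u x \<noteq> 0" for x
  proof -
    have "x \<in> support_on ?D u" using that by (auto simp: support_on_def indicator_def split: if_splits)
    then show ?thesis using closure_subset by blast
  qed
  have "x + h \<in> ?D" if "x \<in> ?D" "h \<in> cone 4" for x h
  proof -
    \<comment> \<open>Along \<open>h\<close>, the graph rises by at most
      \<open>norm h / (4 * d)\<close>, hence by no more than the vertical coordinate
      \<open>h $ k\<close>.\<close>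
    have "norm h \<le> 4 * real CARD('n) * h $ k" using that by (intro cone_norm_le)
    then have "1 / (4 * real CARD('n)) * norm h \<le> h $ k" by (simp add: field_simps)
    moreover have "\<bar>f (x + h) - f x\<bar> \<le> 1 / (4 * real CARD('n)) * norm (x + h - x)"
      by (rule supporting_function_lipschitz[OF f])
    ultimately show ?thesis using that by (simp add: epigraph_of_def)
  qed
  moreover have "(\<lambda>x. indicator ?D x *\<^sub>R u x) \<in> borel_measurable borel"
    using D cu by (rule borel_measurable_continuous_on_indicator)
  moreover have "\<exists>B. \<forall>x. norm (indicator ?D x *\<^sub>R u x) \<le> B"
  proof -
    have "compact (u ` closure (support_on ?D u))"
      using K cu by (intro compact_continuous_image) (auto intro: continuous_on_subset)
    then obtain B where B: "0 < B" "\<And>x. x \<in> closure (support_on ?D u) \<Longrightarrow> norm (u x) \<le> B"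
      using compact_imp_bounded bounded_pos by (metis imageI)
    have "norm (indicator ?D x *\<^sub>R u x) \<le> B" for x
      using supp[of x] B by (cases "indicator ?D x *\<^sub>R u x = 0") (auto simp: indicator_def split: if_splits)
    then show ?thesis by blast
  qed
  moreover have "\<exists>R. \<forall>x. indicator ?D x *\<^sub>R u x \<noteq> 0 \<longrightarrow> norm x \<le> R"
    using compact_imp_bounded[OF K(1)] supp unfolding bounded_iff by blast
  ultimately show ?thesis using D unfolding admissible_def by blast
qed

theorem theorem1p2:
  fixes s p :: real
  assumes "0 < s" "s < 1" "1 < p" "s * p \<noteq> 1"
  shows "\<exists>M0::real. M0 > 0 \<and> (\<exists>C::real. C > 0 \<and>
           (\<forall>(k::'n::finite) (f :: real ^ 'n \<Rightarrow> real).
              supporting_function k f \<and> grad_Linf f < ereal M0 \<longrightarrow>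
              (\<forall>u \<in> C1_c (epigraph_of k f).
                 W_seminorm s p (epigraph_of k f) u
                   \<le> ennreal C * X_seminorm s p (epigraph_of k f) u)))"
proof -
  let ?b = "real CARD('n) + s * p"
  have b: "0 < ?b" using assms by (intro add_pos_pos) auto
  obtain C1 where C1: "0 < C1" "\<And>D (v :: real ^ 'n \<Rightarrow> real ^ 'n). admissible D v \<Longrightarrow>
      full_energy ?b p D v \<le> ennreal C1 * cone_energy ?b p D v 0"
    using full_energy_le_cone_energy[of p ?b, where 'n = 'n] assms b by auto
  obtain C2 where C2: "0 < C2" "\<And>D (v :: real ^ 'n \<Rightarrow> real ^ 'n) e. admissible D v \<Longrightarrow> 0 < e \<Longrightarrow>
      cone_energy ?b p D v e \<le> ennreal C2 * second_energy ?b p D v"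
    using cone_energy_absorb[of s p ?b, where 'n = 'n] assms by auto
  obtain C3 where C3: "0 < C3" "\<And>D (v :: real ^ 'n \<Rightarrow> real ^ 'n). admissible D v \<Longrightarrow>
      second_energy ?b p D v \<le> ennreal C3 * proj_energy ?b p D v"
    using second_energy_le_proj_energy[of p ?b, where 'n = 'n] assms b by auto
  \<comment> \<open>The three constants are fixed before \<open>k\<close>, \<open>f\<close> and
    \<open>u\<close>, which makes \<open>?C\<close> uniform over all epigraphs of slope below
    \<open>?M\<close>.\<close>
  let ?M = "1 / (4 * real CARD('n))" and ?C = "(C1 * C2 * C3) powr (1 / p)"
  have korn: "W_seminorm s p (epigraph_of k f) u \<le> ennreal ?C * X_seminorm s p (epigraph_of k f) u"
    if f: "supporting_function k f" "grad_Linf f < ereal ?M" and u: "u \<in> C1_c (epigraph_of k f)"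
    for k :: 'n and f and u
  proof -
    let ?D = "epigraph_of k f"
    define v where "v x = indicator ?D x *\<^sub>R u x" for x
    have adm: "admissible ?D v"
      using admissible_zero_extension[OF f u] by (simp add: v_def[abs_def])
    then have meas: "?D \<in> sets borel" "v \<in> borel_measurable borel"
      by (auto simp: admissible_def)
    have uv: "u x = v x" if "x \<in> ?D" for x using that by (simp add: v_def)
    have "full_energy ?b p ?D v \<le> ennreal C1 * cone_energy ?b p ?D v 0"
      by (rule C1(2)[OF adm])
    \<comment> \<open>Absorption holds for every \<open>e > 0\<close> with the same
      \<open>C2\<close>, so the bound passes to the untruncated energy.\<close>
    also have "\<dots> \<le> ennreal C1 * (ennreal C2 * second_energy ?b p ?D v)"
      by (intro mult_left_mono cone_energy_SUP adm C2(2)) auto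
    also have "\<dots> \<le> ennreal C1 * (ennreal C2 * (ennreal C3 * proj_energy ?b p ?D v))"
      by (intro mult_left_mono C3(2) adm) auto
    also have "\<dots> = ennreal (C1 * C2 * C3) * proj_energy ?b p ?D v"
      using C1 C2 C3 by (simp add: ennreal_mult mult.assoc)
    finally have "W_energy s p ?D u \<le> ennreal (C1 * C2 * C3) * X_energy s p ?D u"
      using W_energy_eq_full_energy[OF meas uv] X_energy_eq_proj_energy[OF meas uv] by simp
    then show ?thesis
      unfolding W_seminorm_def X_seminorm_def using assms C1(1) C2(1) C3(1)
      by (intro ennroot_le) auto
  qed
  show ?thesis
  proof (rule exI[of _ ?M], rule conjI)
    show "0 < ?M" by simp
    have "0 < ?C" using C1(1) C2(1) C3(1) by simp
    then show "\<exists>C>0. \<forall>(k::'n) f. supporting_function k f \<and> grad_Linf f < ereal ?M \<longrightarrow>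
        (\<forall>u \<in> C1_c (epigraph_of k f). W_seminorm s p (epigraph_of k f) u
           \<le> ennreal C * X_seminorm s p (epigraph_of k f) u)"
      using korn by blast
  qed
qed

end
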